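(* Let $k$ be a field containing $\frac16$ and $\sqrt2$, and let $\mathrm{St}_2(k)=F/R$ be the standard presentation of the Steinberg group. For any $g,h\in F$ whose images commute in $\mathrm{St}_2(k)$, we have $$\mathrm{ocl}(g,h)\le 5\,l_S([g,h])+2.$$
   Context: Notation: $[a,b]=aba^{-1}b^{-1}$. Steinberg group: $\mathrm{St}_2(k)=F/R$ where $F$ is the free group on the symbols $x_\alpha(t)$ with $\alpha\in\{1,-1\}$ and $t\in k$, and $R$ is the normal subgroup normally generated by the set $S$ of all elements $$r^1_\alpha(s,t)=x_\alpha(s+t)x_\alpha(s)^{-1}x_\alpha(t)^{-1}\quad(s,t\in k),$$ $$r^2_\alpha(u,t)=w_\alpha(u)x_\alpha(t)w_\alpha(u)^{-1}x_{-\alpha}(u^{-2}t)\quad(u\in k^*,\ t\in k),$$ for $\alpha=\pm1$, where $w_\alpha(u)=x_\alpha(u)x_{-\alpha}(-u^{-1})x_\alpha(u)$. For $x\in R$, $l_S(x)$ is the minimal number of conjugates (in $F$) of elements of $S\cup S^{-1}$ whose product is $x$. For $g,h\in F$ whose images commute in $\mathrm{St}_2(k)$, $$\mathrm{ocl}(g,h)=\min\Big\{n\in\mathbb{N}: [g,h]=\prod_{i=1}^n[f_i,r_i]^{\pm1}\text{ in }F,\ f_i\in F,\ r_i\in R\Big\}.$$ (That this set is nonempty, i.e. $[g,h]\in[F,R]$, is part of the assertion; it corresponds to $H_2(\mathrm{St}_2(k),\mathbb{Z})=0$.) *)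

theory Defs
  imports "HOL-Algebra.Coset"
begin

section \<open>Free groups\<close>

text \<open>
  The free group on a set \<open>X\<close> consists of the reduced words in the letters \<open>(x, True)\<close>, standing
  for \<open>x\<close>, and \<open>(x, False)\<close>, standing for the inverse of \<open>x\<close>, with \<open>x \<in> X\<close>.
\<close>

type_synonym 'x word = "('x \<times> bool) list"

definition opposite :: "'x \<times> bool \<Rightarrow> 'x \<times> bool \<Rightarrow> bool" where
  "opposite a b \<longleftrightarrow> fst a = fst b \<and> snd a \<noteq> snd b"

definition reduced :: "'x word \<Rightarrow> bool" where
  "reduced w \<longleftrightarrow> successively (\<lambda>a b. \<not> opposite a b) w"

fun cancel_cons :: "'x \<times> bool \<Rightarrow> 'x word \<Rightarrow> 'x word" where
  "cancel_cons a [] = [a]"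
| "cancel_cons a (b # w) = (if opposite a b then w else a # b # w)"

definition reduce :: "'x word \<Rightarrow> 'x word" where
  "reduce w = foldr cancel_cons w []"

definition free_group :: "'x set \<Rightarrow> 'x word monoid" where
  "free_group X =
     \<lparr>carrier = {w. set w \<subseteq> X \<times> UNIV \<and> reduced w},
      monoid.mult = (\<lambda>v w. reduce (v @ w)),
      one = []\<rparr>"

lemma reduced_Nil [simp]: "reduced []"
  by (simp add: reduced_def)

lemma reduced_ConsD: "reduced (a # w) \<Longrightarrow> reduced w"
  by (cases w) (auto simp: reduced_def)

lemma reduced_cancel_cons: "reduced w \<Longrightarrow> reduced (cancel_cons a w)"
  by (cases w rule: list.exhaust) (auto simp: reduced_def dest: reduced_ConsD[unfolded reduced_def])

lemma reduced_foldr: "reduced w \<Longrightarrow> reduced (foldr cancel_cons v w)"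
  by (induction v) (auto intro: reduced_cancel_cons)

lemma reduce_reduced: "reduced w \<Longrightarrow> reduce w = w"
proof (induction w)
  case (Cons a w)
  then have "reduce w = w" by (blast dest: reduced_ConsD)
  with Cons.prems show ?case
    by (cases w) (auto simp: reduce_def reduced_def)
qed (simp add: reduce_def)

lemma cancel_cons_opposite:
  assumes "reduced w" "opposite a b"
  shows "cancel_cons a (cancel_cons b w) = w"
proof (cases w)
  case Nil
  with assms show ?thesis by simp
next
  case (Cons c v)
  show ?thesis
  proof (cases "opposite b c")
    case True
    then have "a = c" using assms(2) by (auto simp: opposite_def prod_eq_iff)
    with True Cons assms(1) show ?thesis
      by (cases v) (auto simp: reduced_def)
  qed (use Cons assms in auto)
qed

lemma foldr_cancel_cons:
  assumes "reduced w" "reduced v"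
  shows "foldr cancel_cons (cancel_cons a v) w = cancel_cons a (foldr cancel_cons v w)"
proof (cases v)
  case (Cons b u)
  then show ?thesis
    using assms by (auto simp: cancel_cons_opposite reduced_foldr)
qed simp

lemma foldr_reduce:
  "reduced w \<Longrightarrow> foldr cancel_cons (reduce v) w = foldr cancel_cons v w"
  by (induction v) (simp_all add: reduce_def foldr_cancel_cons reduced_foldr)

lemma reduced_reduce: "reduced (reduce w)"
  by (simp add: reduce_def reduced_foldr)

lemma reduce_append: "reduce (v @ w) = foldr cancel_cons v (reduce w)"
  by (simp add: reduce_def)

lemma set_cancel_cons: "set (cancel_cons a w) \<subseteq> insert a (set w)"
  by (cases w) auto

lemma set_reduce: "set (reduce w) \<subseteq> set w"
proof (induction w)
  case (Cons a w)
  then show ?case using set_cancel_cons[of a "reduce w"] by (auto simp: reduce_def)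
qed (simp add: reduce_def)

lemma foldr_cancel_cons_inverse:
  "foldr cancel_cons (rev (map (apsnd Not) w)) (foldr cancel_cons w []) = []"
proof -
  have "foldr cancel_cons (rev (map (apsnd Not) w)) (foldr cancel_cons w v) = v" if "reduced v" for v :: "'a word"
    using that
  proof (induction w arbitrary: v)
    case (Cons a w)
    have "opposite (apsnd Not a) a" by (cases a) (simp add: opposite_def)
    with Cons show ?case by (simp add: cancel_cons_opposite reduced_foldr)
  qed simp
  then show ?thesis by simp
qed

lemma reduced_inverse: "reduced w \<Longrightarrow> reduced (rev (map (apsnd Not) w))"
proof -
  have "opposite (apsnd Not b) (apsnd Not a) = opposite a b" for a b :: "'a \<times> bool"
    by (cases a; cases b) (auto simp: opposite_def)
  then show "reduced w \<Longrightarrow> reduced (rev (map (apsnd Not) w))"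
    by (simp add: reduced_def successively_rev successively_map)
qed

lemma group_free_group: "group (free_group X)"
proof (rule groupI)
  fix u v w
  assume "u \<in> carrier (free_group X)" "v \<in> carrier (free_group X)" "w \<in> carrier (free_group X)"
  then have w: "reduced w" by (simp add: free_group_def)
  have "reduce (reduce (u @ v) @ w) = foldr cancel_cons (reduce (u @ v)) w"
    by (simp add: reduce_append[of "reduce (u @ v)"] reduce_reduced w)
  also have "\<dots> = foldr cancel_cons u (foldr cancel_cons v w)"
    by (simp add: foldr_reduce w)
  also have "\<dots> = reduce (u @ reduce (v @ w))"
    by (simp add: reduce_append reduce_reduced reduced_foldr w)
  finally show "u \<otimes>\<^bsub>free_group X\<^esub> v \<otimes>\<^bsub>free_group X\<^esub> w = u \<otimes>\<^bsub>free_group X\<^esub> (v \<otimes>\<^bsub>free_group X\<^esub> w)"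
    by (simp add: free_group_def)
next
  fix v w
  assume "v \<in> carrier (free_group X)" "w \<in> carrier (free_group X)"
  then show "v \<otimes>\<^bsub>free_group X\<^esub> w \<in> carrier (free_group X)"
    using set_reduce[of "v @ w"] by (auto simp: free_group_def reduced_reduce)
next
  fix w
  assume w: "w \<in> carrier (free_group X)"
  let ?v = "rev (map (apsnd Not) w)"
  have "reduce (?v @ w) = []"
    using foldr_cancel_cons_inverse[of w] by (simp add: reduce_append reduce_def)
  moreover have "?v \<in> carrier (free_group X)"
    using w reduced_inverse[of w] by (fastforce simp: free_group_def)
  ultimately show "\<exists>v \<in> carrier (free_group X). v \<otimes>\<^bsub>free_group X\<^esub> w = \<one>\<^bsub>free_group X\<^esub>"
    by (intro bexI[of _ ?v]) (simp_all add: free_group_def)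
qed (auto simp: free_group_def reduce_reduced)


section \<open>Normal closures and word lengths\<close>

definition commutator :: "('a, 'b) monoid_scheme \<Rightarrow> 'a \<Rightarrow> 'a \<Rightarrow> 'a" where
  "commutator G a b = a \<otimes>\<^bsub>G\<^esub> b \<otimes>\<^bsub>G\<^esub> inv\<^bsub>G\<^esub> a \<otimes>\<^bsub>G\<^esub> inv\<^bsub>G\<^esub> b"

definition normal_closure :: "('a, 'b) monoid_scheme \<Rightarrow> 'a set \<Rightarrow> 'a set" where
  "normal_closure G A = \<Inter> {N. N \<lhd> G \<and> A \<subseteq> N}"

definition with_inverses :: "('a, 'b) monoid_scheme \<Rightarrow> 'a set \<Rightarrow> 'a set" where
  "with_inverses G A = A \<union> m_inv G ` A"

definition conjugates :: "('a, 'b) monoid_scheme \<Rightarrow> 'a set \<Rightarrow> 'a set" where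
  "conjugates G A = {f \<otimes>\<^bsub>G\<^esub> a \<otimes>\<^bsub>G\<^esub> inv\<^bsub>G\<^esub> f | f a. f \<in> carrier G \<and> a \<in> A}"

text \<open>The numbers \<open>n\<close> such that \<open>x\<close> is a product of \<open>n\<close> elements of \<open>A\<close>; the empty product is allowed.\<close>

definition product_lengths :: "('a, 'b) monoid_scheme \<Rightarrow> 'a set \<Rightarrow> 'a \<Rightarrow> nat set" where
  "product_lengths G A x =
     {n. \<exists>as. length as = n \<and> set as \<subseteq> A \<and> foldr (\<otimes>\<^bsub>G\<^esub>) as \<one>\<^bsub>G\<^esub> = x}"


section \<open>The standard presentation of the Steinberg group\<close>

definition st_free :: "(int \<times> 'k::field) word monoid" where
  "st_free = free_group ({1, -1} \<times> UNIV)"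

definition st_x :: "int \<Rightarrow> 'k::field \<Rightarrow> (int \<times> 'k) word" where
  "st_x \<alpha> t = [((\<alpha>, t), True)]"

definition st_w :: "int \<Rightarrow> 'k::field \<Rightarrow> (int \<times> 'k) word" where
  "st_w \<alpha> u = st_x \<alpha> u \<otimes>\<^bsub>st_free\<^esub> st_x (- \<alpha>) (- inverse u) \<otimes>\<^bsub>st_free\<^esub> st_x \<alpha> u"

definition st_r1 :: "int \<Rightarrow> 'k::field \<Rightarrow> 'k \<Rightarrow> (int \<times> 'k) word" where
  "st_r1 \<alpha> s t =
     st_x \<alpha> (s + t) \<otimes>\<^bsub>st_free\<^esub> inv\<^bsub>st_free\<^esub> (st_x \<alpha> s) \<otimes>\<^bsub>st_free\<^esub> inv\<^bsub>st_free\<^esub> (st_x \<alpha> t)"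

definition st_r2 :: "int \<Rightarrow> 'k::field \<Rightarrow> 'k \<Rightarrow> (int \<times> 'k) word" where
  "st_r2 \<alpha> u t =
     st_w \<alpha> u \<otimes>\<^bsub>st_free\<^esub> st_x \<alpha> t \<otimes>\<^bsub>st_free\<^esub> inv\<^bsub>st_free\<^esub> (st_w \<alpha> u)
       \<otimes>\<^bsub>st_free\<^esub> st_x (- \<alpha>) (inverse (u ^ 2) * t)"

definition st_S :: "(int \<times> 'k::field) word set" where
  "st_S = {st_r1 \<alpha> s t | \<alpha> s t. \<alpha> \<in> {1, -1}} \<union> {st_r2 \<alpha> u t | \<alpha> u t. \<alpha> \<in> {1, -1} \<and> u \<noteq> 0}"

definition st_R :: "(int \<times> 'k::field) word set" where
  "st_R = normal_closure st_free st_S"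

definition steinberg :: "(int \<times> 'k::field) word set monoid" where
  "steinberg = st_free Mod st_R"

text \<open>Only meaningful for \<open>x \<in> st_R\<close>.\<close>

definition l_S :: "(int \<times> 'k::field) word \<Rightarrow> nat" where
  "l_S x = (LEAST n. n \<in> product_lengths st_free (conjugates st_free (with_inverses st_free st_S)) x)"

definition ocl_lengths :: "(int \<times> 'k::field) word \<Rightarrow> (int \<times> 'k) word \<Rightarrow> nat set" where
  "ocl_lengths g h =
     product_lengths st_free
       (with_inverses st_free {commutator st_free f r | f r. f \<in> carrier st_free \<and> r \<in> st_R})
       (commutator st_free g h)"

text \<open>
  Only meaningful if \<open>ocl_lengths g h \<noteq> {}\<close>, that is, if the commutator of \<open>g\<close> and \<open>h\<close> lies in
  \<open>[F, R]\<close>.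
\<close>

definition ocl :: "(int \<times> 'k::field) word \<Rightarrow> (int \<times> 'k) word \<Rightarrow> nat" where
  "ocl g h = (LEAST n. n \<in> ocl_lengths g h)"

end

theory Submission
  imports Defs
begin

text \<open>
  Write \<open>F\<close> for the free group, \<open>R\<close> for the normal closure of the relators, and call a commutator
  \<open>[f, r]\<close> with \<open>f \<in> F\<close> and \<open>r \<in> R\<close>, or the inverse of one, a mixed commutator. They generate
  \<open>[F, R]\<close>, and \<open>F/[F, R]\<close> is a central extension of the Steinberg group \<open>F/R\<close>. It splits, because
  the Steinberg group is perfect with vanishing \<open>H\<^sub>2\<close>. The proof makes the splitting explicit and
  counts the mixed commutators that each relation costs.

  The splitting is induced by an endomorphism \<open>\<Phi>\<close> of \<open>F\<close> with \<open>\<Phi>(x) \<equiv> x\<close> modulo \<open>R\<close>. Take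
  \<open>c\<close> with \<open>c\<^sup>2 = 2\<close> and the torus word \<open>h\<^sub>\<alpha> = w\<^sub>\<alpha>(c) w\<^sub>\<alpha>(-1)\<close>; in the Steinberg group it
  conjugates \<open>x\<^sub>\<alpha>(t)\<close> to \<open>x\<^sub>\<alpha>(2t)\<close>, so that \<open>[h\<^sub>\<alpha>, x\<^sub>\<alpha>(t)]\<close> is again a lift of
  \<open>x\<^sub>\<alpha>(t)\<close>. Up to the order of the factors this commutator is \<open>\<Phi>(x\<^sub>\<alpha>(t))\<close>.

  Replacing an entry of a commutator by a congruent one modulo \<open>R\<close> costs one mixed commutator
  (\<open>near_commutator_left\<close>, \<open>near_commutator_right\<close>). Hence \<open>[g, h]\<close> differs from
  \<open>[\<Phi>(g), \<Phi>(h)] = \<Phi>([g, h])\<close> by two of them; and if \<open>[g, h]\<close> is a product of \<open>n\<close> conjugates of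
  relators and their inverses, then \<open>\<Phi>([g, h])\<close> is a product of \<open>n\<close> conjugates of elements
  \<open>\<Phi>(r)\<^sup>\<plusminus>\<^sup>1\<close>. It remains to see that \<open>\<Phi>(r)\<close> is a product of five mixed commutators for every
  relator \<open>r\<close>.

  For the additivity relators, replacing \<open>x\<^sub>\<alpha>(s + t)\<close> by \<open>x\<^sub>\<alpha>(t) x\<^sub>\<alpha>(s)\<close> costs one and leaves a
  conjugate of a commutator of two lifts of elements of one root subgroup. Such a commutator costs
  three (\<open>near_commutator_root_subgroup\<close>). The reason is that the commutator pairing \<open>B\<close> on the root
  subgroup is biadditive and invariant under doubling both arguments; so \<open>3B = 0\<close>, and \<open>B = 0\<close>
  because \<open>3\<close> is invertible.

  For the Weyl relators, replacing \<open>\<Phi>(w\<^sub>\<alpha>(u))\<close> by \<open>w\<^sub>\<alpha>(u)\<close> costs one and replacing \<open>x\<^bsub>-\<alpha>\<^esub>\<close> by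
  a conjugate of \<open>x\<^sub>\<alpha>\<close> costs one. What is left compares the actions of two lifts of one torus
  element, \<open>h\<^bsub>-\<alpha>\<^esub>\<close> and \<open>w\<^sub>\<alpha>(u) h\<^sub>\<alpha> w\<^sub>\<alpha>(u)\<^sup>-\<^sup>1\<close>. In the Steinberg group their quotient is
  central, because it commutes with all generators; so it acts trivially on the commutator
  \<open>[h\<^bsub>-\<alpha>\<^esub>, x\<^bsub>-\<alpha>\<^esub>]\<close>, at a cost of three (\<open>near_commutator_central\<close>).
\<close>

section \<open>Computing with words in a group\<close>

lemma (in group) inv_mult_cancel_left:
  "x \<in> carrier G \<Longrightarrow> y \<in> carrier G \<Longrightarrow> inv x \<otimes> (x \<otimes> y) = y"
  by (simp flip: m_assoc)

lemma (in group) mult_inv_cancel_left: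
  "x \<in> carrier G \<Longrightarrow> y \<in> carrier G \<Longrightarrow> x \<otimes> (inv x \<otimes> y) = y"
  by (simp flip: m_assoc)

text \<open>These rules decide whether two words in elements of a group are equal in the free group.\<close>

lemmas (in group) word_simps =
  m_assoc inv_mult_group inv_mult_cancel_left mult_inv_cancel_left commutator_def

lemma (in group) commutator_closed [simp]:
  "x \<in> carrier G \<Longrightarrow> y \<in> carrier G \<Longrightarrow> commutator G x y \<in> carrier G"
  by (simp add: commutator_def)

lemma (in group_hom) hom_commutator:
  "x \<in> carrier G \<Longrightarrow> y \<in> carrier G \<Longrightarrow> h (commutator G x y) = commutator H (h x) (h y)"
  by (simp add: commutator_def)

text \<open>
  Both sides express that the commutator pairing satisfies \<open>B(2a, d) = B(a, 2d)\<close>. With these orders of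
  the factors the identity holds in every group, without any correction.
\<close>

lemma (in group) swap_commutators:
  assumes "a \<in> carrier G" "d \<in> carrier G"
  shows "commutator G (a \<otimes> d \<otimes> a \<otimes> inv d) d = commutator G a (d \<otimes> a \<otimes> d \<otimes> inv a)"
  using assms by (simp add: word_simps)

section \<open>Lengths of products\<close>

lemma product_lengths_0_iff: "0 \<in> product_lengths G C x \<longleftrightarrow> x = \<one>\<^bsub>G\<^esub>"
  by (auto simp: product_lengths_def)

lemma product_lengths_Suc_iff:
  "Suc n \<in> product_lengths G C x \<longleftrightarrow> (\<exists>a\<in>C. \<exists>y. n \<in> product_lengths G C y \<and> x = a \<otimes>\<^bsub>G\<^esub> y)"
  (is "?l \<longleftrightarrow> ?r")
proof
  assume ?l
  then obtain a as where "length as = n" "set (a # as) \<subseteq> C" "foldr (\<otimes>\<^bsub>G\<^esub>) (a # as) \<one>\<^bsub>G\<^esub> = x"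
    unfolding product_lengths_def by (auto simp: length_Suc_conv)
  then show ?r by (auto simp: product_lengths_def)
next
  assume ?r
  then obtain a as where "a \<in> C" "length as = n" "set as \<subseteq> C" "x = a \<otimes>\<^bsub>G\<^esub> foldr (\<otimes>\<^bsub>G\<^esub>) as \<one>\<^bsub>G\<^esub>"
    by (auto simp: product_lengths_def)
  then show ?l by (auto simp: product_lengths_def intro!: exI[of _ "a # as"])
qed

lemma (in monoid) product_lengths_closed:
  assumes "C \<subseteq> carrier G" "n \<in> product_lengths G C x"
  shows "x \<in> carrier G"
  using assms by (induction n arbitrary: x) (auto simp: product_lengths_0_iff product_lengths_Suc_iff)

lemma (in monoid) product_lengths_mult:
  assumes C: "C \<subseteq> carrier G" and "m \<in> product_lengths G C x" and n: "n \<in> product_lengths G C y"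
  shows "m + n \<in> product_lengths G C (x \<otimes> y)"
  using assms(2)
proof (induction m arbitrary: x)
  case 0
  with product_lengths_closed[OF C n] n show ?case by (simp add: product_lengths_0_iff)
next
  case (Suc m)
  then obtain a z where a: "a \<in> C" "m \<in> product_lengths G C z" "x = a \<otimes> z"
    by (auto simp: product_lengths_Suc_iff)
  then have "x \<otimes> y = a \<otimes> (z \<otimes> y)"
    using C product_lengths_closed[OF C] n by (auto intro: m_assoc)
  with a Suc.IH show ?case by (auto simp: product_lengths_Suc_iff)
qed

lemma (in monoid) product_lengths_1:
  "C \<subseteq> carrier G \<Longrightarrow> a \<in> C \<Longrightarrow> 1 \<in> product_lengths G C a"
  by (auto simp: product_lengths_Suc_iff product_lengths_0_iff intro!: bexI[of _ a])

lemma (in group_hom) product_lengths_hom: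
  assumes C: "C \<subseteq> carrier G" and "h ` C \<subseteq> D" and "n \<in> product_lengths G C x"
  shows "n \<in> product_lengths H D (h x)"
  using assms(3)
proof (induction n arbitrary: x)
  case (Suc n)
  then obtain a z where a: "a \<in> C" "n \<in> product_lengths G C z" "x = a \<otimes> z"
    by (auto simp: product_lengths_Suc_iff)
  then have "h x = h a \<otimes>\<^bsub>H\<^esub> h z"
    using C G.product_lengths_closed[OF C] by auto
  with a Suc.IH assms(2) show ?case by (auto simp: product_lengths_Suc_iff)
qed (simp add: product_lengths_0_iff)

lemma (in group) product_lengths_inv:
  assumes C: "C \<subseteq> carrier G" and inv: "\<And>a. a \<in> C \<Longrightarrow> inv a \<in> C"
    and "n \<in> product_lengths G C x"
  shows "n \<in> product_lengths G C (inv x)"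
  using assms(3)
proof (induction n arbitrary: x)
  case (Suc n)
  then obtain a z where a: "a \<in> C" "n \<in> product_lengths G C z" "x = a \<otimes> z"
    by (auto simp: product_lengths_Suc_iff)
  then have "inv x = inv z \<otimes> inv a"
    using C product_lengths_closed[OF C] by (auto simp: inv_mult_group)
  moreover have "n + 1 \<in> product_lengths G C (inv z \<otimes> inv a)"
    using a by (intro product_lengths_mult product_lengths_1 Suc.IH inv C)
  ultimately show ?case by simp
qed (simp add: product_lengths_0_iff)

lemma (in group) conjugation_hom:
  assumes "g \<in> carrier G"
  shows "group_hom G G (\<lambda>x. g \<otimes> x \<otimes> inv g)"
  by unfold_locales (use assms in \<open>auto simp: hom_def word_simps\<close>)

lemma (in group) product_lengths_conj:
  assumes "C \<subseteq> carrier G" and "\<And>a g. a \<in> C \<Longrightarrow> g \<in> carrier G \<Longrightarrow> g \<otimes> a \<otimes> inv g \<in> C"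
    and "n \<in> product_lengths G C x" "g \<in> carrier G"
  shows "n \<in> product_lengths G C (g \<otimes> x \<otimes> inv g)"
  using assms by (intro group_hom.product_lengths_hom[OF conjugation_hom[of g]]) auto

section \<open>Normal closures\<close>

lemma (in group) with_inverses_closed:
  "C \<subseteq> carrier G \<Longrightarrow> with_inverses G C \<subseteq> carrier G"
  by (auto simp: with_inverses_def)

lemma (in group) inv_in_with_inverses:
  "C \<subseteq> carrier G \<Longrightarrow> a \<in> with_inverses G C \<Longrightarrow> inv a \<in> with_inverses G C"
  by (force simp: with_inverses_def)

lemma (in group) conjugates_closed:
  "C \<subseteq> carrier G \<Longrightarrow> conjugates G C \<subseteq> carrier G"
  by (auto simp: conjugates_def)

lemma (in group) conj_in_conjugates:
  assumes "C \<subseteq> carrier G" "a \<in> conjugates G C" "g \<in> carrier G"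
  shows "g \<otimes> a \<otimes> inv g \<in> conjugates G C"
proof -
  obtain f c where "a = f \<otimes> c \<otimes> inv f" "f \<in> carrier G" "c \<in> C"
    using assms(2) by (auto simp: conjugates_def)
  then have "g \<otimes> a \<otimes> inv g = (g \<otimes> f) \<otimes> c \<otimes> inv (g \<otimes> f)" "g \<otimes> f \<in> carrier G" "c \<in> C"
    using assms by (auto simp: word_simps)
  then show ?thesis unfolding conjugates_def by blast
qed

lemma (in group) inv_in_conjugates:
  assumes "C \<subseteq> carrier G" "\<And>a. a \<in> C \<Longrightarrow> inv a \<in> C" "a \<in> conjugates G C"
  shows "inv a \<in> conjugates G C"
proof -
  obtain f c where "a = f \<otimes> c \<otimes> inv f" "f \<in> carrier G" "c \<in> C"
    using assms(3) by (auto simp: conjugates_def)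
  then have "inv a = f \<otimes> inv c \<otimes> inv f" "f \<in> carrier G" "inv c \<in> C"
    using assms by (auto simp: word_simps)
  then show ?thesis unfolding conjugates_def by blast
qed

lemma (in group) normal_products:
  assumes C: "C \<subseteq> carrier G"
    and inv: "\<And>a. a \<in> C \<Longrightarrow> inv a \<in> C"
    and conj: "\<And>a g. a \<in> C \<Longrightarrow> g \<in> carrier G \<Longrightarrow> g \<otimes> a \<otimes> inv g \<in> C"
  shows "{x. product_lengths G C x \<noteq> {}} \<lhd> G"
  unfolding normal_inv_iff
proof (intro conjI ballI)
  show "subgroup {x. product_lengths G C x \<noteq> {}} G"
  proof (rule subgroup.intro)
    show "{x. product_lengths G C x \<noteq> {}} \<subseteq> carrier G"
      using product_lengths_closed[OF C] by blast
    show "\<one> \<in> {x. product_lengths G C x \<noteq> {}}"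
      using product_lengths_0_iff[of G C] by blast
    fix x y assume "x \<in> {x. product_lengths G C x \<noteq> {}}"
    then obtain m where m: "m \<in> product_lengths G C x" by blast
    then show "inv x \<in> {x. product_lengths G C x \<noteq> {}}"
      using product_lengths_inv[OF C inv] by blast
    assume "y \<in> {x. product_lengths G C x \<noteq> {}}"
    with m show "x \<otimes> y \<in> {x. product_lengths G C x \<noteq> {}}"
      using product_lengths_mult[OF C] by blast
  qed
  fix g x assume "g \<in> carrier G" "x \<in> {x. product_lengths G C x \<noteq> {}}"
  then show "g \<otimes> x \<otimes> inv g \<in> {x. product_lengths G C x \<noteq> {}}"
    using product_lengths_conj[OF C conj] by blast
qed

lemma (in group) normal_conjugate_products:
  assumes A: "A \<subseteq> carrier G"
  shows "{x. product_lengths G (conjugates G (with_inverses G A)) x \<noteq> {}} \<lhd> G"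
proof -
  note W = with_inverses_closed[OF A] inv_in_with_inverses[OF A]
  show ?thesis
    using conjugates_closed[OF W(1)] conj_in_conjugates[OF W(1)] inv_in_conjugates[OF W]
    by (intro normal_products) auto
qed

lemma (in group) normal_closure_eq:
  assumes A: "A \<subseteq> carrier G"
  shows "normal_closure G A = {x. product_lengths G (conjugates G (with_inverses G A)) x \<noteq> {}}"
    (is "_ = ?P")
proof
  let ?C = "conjugates G (with_inverses G A)"
  have C: "?C \<subseteq> carrier G" by (rule conjugates_closed[OF with_inverses_closed[OF A]])
  have "?P \<lhd> G" by (rule normal_conjugate_products[OF A])
  moreover have "A \<subseteq> ?P"
  proof
    fix a assume a: "a \<in> A"
    with A have "a = \<one> \<otimes> a \<otimes> inv \<one>" by auto
    with a have "a \<in> ?C"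
      unfolding conjugates_def with_inverses_def by blast
    then show "a \<in> ?P" using product_lengths_1[OF C] by blast
  qed
  ultimately show "normal_closure G A \<subseteq> ?P" unfolding normal_closure_def by blast
  show "?P \<subseteq> normal_closure G A"
    unfolding normal_closure_def
  proof (intro subsetI InterI)
    fix x N assume "x \<in> ?P" and "N \<in> {N. N \<lhd> G \<and> A \<subseteq> N}"
    then obtain n where x: "n \<in> product_lengths G ?C x" and N: "N \<lhd> G" "A \<subseteq> N" by blast
    interpret N: normal N G by (rule N)
    have sub: "?C \<subseteq> N"
      using N(2) N.inv_op_closed2 by (auto simp: conjugates_def with_inverses_def)
    show "x \<in> N" using x
    proof (induction n arbitrary: x)
      case 0 then show ?case by (simp add: product_lengths_0_iff)
    next
      case (Suc n) then show ?case using sub by (auto simp: product_lengths_Suc_iff)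
    qed
  qed
qed

lemma (in group) normal_normal_closure:
  "A \<subseteq> carrier G \<Longrightarrow> normal_closure G A \<lhd> G"
  by (simp add: normal_closure_eq normal_conjugate_products)

section \<open>Distance in mixed commutators\<close>

text \<open>The commutators of arbitrary elements with elements of \<open>R\<close>, together with their inverses.\<close>

definition mixed_commutators :: "('a, 'b) monoid_scheme \<Rightarrow> 'a set \<Rightarrow> 'a set" where
  "mixed_commutators G R =
     with_inverses G {commutator G f r | f r. f \<in> carrier G \<and> r \<in> R}"

text \<open>
  The quotient of \<open>x\<close> by \<open>y\<close> is a product of \<open>n\<close> mixed commutators. For normal \<open>R\<close> this is
  compatible with products and inverses, and the numbers add up under composition.
\<close>

definition near :: "('a, 'b) monoid_scheme \<Rightarrow> 'a set \<Rightarrow> nat \<Rightarrow> 'a \<Rightarrow> 'a \<Rightarrow> bool" where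
  "near G R n x y \<longleftrightarrow> x \<in> carrier G \<and> y \<in> carrier G \<and>
     n \<in> product_lengths G (mixed_commutators G R) (x \<otimes>\<^bsub>G\<^esub> inv\<^bsub>G\<^esub> y)"

context normal
begin

lemma mixed_commutators_closed: "mixed_commutators G H \<subseteq> carrier G"
  unfolding mixed_commutators_def by (rule with_inverses_closed) auto

lemma inv_in_mixed_commutators:
  "a \<in> mixed_commutators G H \<Longrightarrow> inv a \<in> mixed_commutators G H"
  unfolding mixed_commutators_def by (rule inv_in_with_inverses) auto

lemma conj_in_mixed_commutators:
  assumes "a \<in> mixed_commutators G H" "g \<in> carrier G"
  shows "g \<otimes> a \<otimes> inv g \<in> mixed_commutators G H"
proof -
  interpret c: group_hom G G "\<lambda>x. g \<otimes> x \<otimes> inv g" by (rule conjugation_hom) fact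
  let ?C = "{commutator G f r | f r. f \<in> carrier G \<and> r \<in> H}"
  have *: "g \<otimes> b \<otimes> inv g \<in> ?C" "b \<in> carrier G" if b: "b \<in> ?C" for b
  proof -
    obtain f r where fr: "f \<in> carrier G" "r \<in> H" "b = commutator G f r"
      using b by blast
    then have "g \<otimes> b \<otimes> inv g = commutator G (g \<otimes> f \<otimes> inv g) (g \<otimes> r \<otimes> inv g)"
      by (auto intro: c.hom_commutator)
    moreover have "g \<otimes> f \<otimes> inv g \<in> carrier G" "g \<otimes> r \<otimes> inv g \<in> H"
      using fr assms inv_op_closed2 by auto
    ultimately show "g \<otimes> b \<otimes> inv g \<in> ?C" by blast
    show "b \<in> carrier G" using fr by simp
  qed
  have "a \<in> ?C \<union> m_inv G ` ?C"
    using assms(1) by (simp only: mixed_commutators_def with_inverses_def)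
  then show ?thesis
  proof (elim UnE imageE)
    assume "a \<in> ?C"
    then show ?thesis unfolding mixed_commutators_def with_inverses_def by (intro UnI1 *)
  next
    fix b assume b: "b \<in> ?C" "a = inv b"
    have "g \<otimes> a \<otimes> inv g = inv (g \<otimes> b \<otimes> inv g)"
      unfolding b(2) using *(2)[OF b(1)] assms(2) by (simp add: word_simps)
    then show ?thesis
      unfolding mixed_commutators_def with_inverses_def using *(1)[OF b(1)] by (intro UnI2 image_eqI)
  qed
qed

lemma near_refl: "x \<in> carrier G \<Longrightarrow> near G H 0 x x"
  by (simp add: near_def product_lengths_0_iff)

lemma near_trans:
  assumes "near G H m x y" "near G H n y z"
  shows "near G H (m + n) x z"
proof -
  have "(x \<otimes> inv y) \<otimes> (y \<otimes> inv z) = x \<otimes> inv z"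
    using assms by (simp add: near_def word_simps)
  with product_lengths_mult[OF mixed_commutators_closed, of m "x \<otimes> inv y" n "y \<otimes> inv z"] assms
  show ?thesis by (simp add: near_def)
qed

lemma near_mult_left:
  assumes "near G H n x y" "g \<in> carrier G"
  shows "near G H n (g \<otimes> x) (g \<otimes> y)"
proof -
  have "(g \<otimes> x) \<otimes> inv (g \<otimes> y) = g \<otimes> (x \<otimes> inv y) \<otimes> inv g"
    using assms by (simp add: near_def word_simps)
  moreover have "n \<in> product_lengths G (mixed_commutators G H) (g \<otimes> (x \<otimes> inv y) \<otimes> inv g)"
    using assms
    by (intro product_lengths_conj mixed_commutators_closed conj_in_mixed_commutators) (auto simp: near_def)
  ultimately show ?thesis using assms by (simp add: near_def)
qed

lemma near_mult_right:
  assumes "near G H n x y" "g \<in> carrier G"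
  shows "near G H n (x \<otimes> g) (y \<otimes> g)"
proof -
  have "(x \<otimes> g) \<otimes> inv (y \<otimes> g) = x \<otimes> inv y"
    using assms by (simp add: near_def word_simps)
  then show ?thesis using assms by (simp add: near_def)
qed

lemma near_mult:
  assumes "near G H m x x'" "near G H n y y'"
  shows "near G H (m + n) (x \<otimes> y) (x' \<otimes> y')"
proof (rule near_trans)
  show "near G H m (x \<otimes> y) (x' \<otimes> y)"
    using assms by (intro near_mult_right) (auto simp: near_def)
  show "near G H n (x' \<otimes> y) (x' \<otimes> y')"
    using assms by (intro near_mult_left) (auto simp: near_def)
qed

lemma near_inv:
  assumes "near G H n x y"
  shows "near G H n (inv x) (inv y)"
proof -
  have xy: "x \<in> carrier G" "y \<in> carrier G" using assms by (auto simp: near_def)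
  have "n \<in> product_lengths G (mixed_commutators G H) (inv (x \<otimes> inv y))"
    using assms
    by (intro product_lengths_inv mixed_commutators_closed inv_in_mixed_commutators) (auto simp: near_def)
  then have "near G H n (y \<otimes> inv x) \<one>" using xy by (simp add: near_def word_simps)
  from near_mult_left[OF this, of "inv y"] show ?thesis using xy by (simp add: word_simps)
qed

lemma near_conj:
  assumes "near G H n x y" "g \<in> carrier G"
  shows "near G H n (g \<otimes> x \<otimes> inv g) (g \<otimes> y \<otimes> inv g)"
  using near_mult_right[OF near_mult_left[OF assms], of "inv g"] assms by simp

lemma near_Suc:
  assumes "near G H n x y"
  shows "near G H (Suc n) x y"
proof -
  have "commutator G \<one> \<one> \<in> mixed_commutators G H"
    unfolding mixed_commutators_def with_inverses_def using one_closed subgroup.one_closed[OF subgroup_axioms] by blast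
  then have "1 \<in> product_lengths G (mixed_commutators G H) \<one>"
    using product_lengths_1[OF mixed_commutators_closed] by (simp add: commutator_def)
  then have "near G H 1 x x" using assms by (simp add: near_def)
  from near_trans[OF this assms] show ?thesis by simp
qed

lemma cosets_eqE:
  assumes "H #> a = H #> b" "a \<in> carrier G" "b \<in> carrier G"
  obtains r where "r \<in> H" "a = r \<otimes> b"
  using rcos_self[OF assms(2)] assms(1) subgroup_axioms by (auto simp: r_coset_def)

text \<open>
  If \<open>a = r b\<close> with \<open>r\<close> in the normal subgroup, then the conjugates of \<open>g\<close> by \<open>a\<close> and \<open>b\<close> differ by
  the commutator of \<open>r\<close> with the second of them. Every other estimate reduces to this one.
\<close>

lemma near_conj_cong:
  assumes "H #> a = H #> b" "a \<in> carrier G" "b \<in> carrier G" "g \<in> carrier G"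
  shows "near G H 1 (a \<otimes> g \<otimes> inv a) (b \<otimes> g \<otimes> inv b)"
proof -
  obtain r where r: "r \<in> H" "a = r \<otimes> b" using cosets_eqE assms by metis
  let ?y = "b \<otimes> g \<otimes> inv b"
  have "inv (commutator G ?y r) \<in> mixed_commutators G H"
    using r assms by (intro inv_in_mixed_commutators) (auto simp: mixed_commutators_def with_inverses_def)
  moreover have "inv (commutator G ?y r) = (a \<otimes> g \<otimes> inv a) \<otimes> inv ?y"
    using r assms by (simp add: word_simps)
  ultimately show ?thesis
    using product_lengths_1[OF mixed_commutators_closed] assms by (simp add: near_def)
qed

lemma near_commutator_left:
  assumes "H #> a = H #> b" "a \<in> carrier G" "b \<in> carrier G" "g \<in> carrier G"
  shows "near G H 1 (commutator G a g) (commutator G b g)"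
  using near_mult_right[OF near_conj_cong[OF assms], of "inv g"] assms by (simp add: commutator_def)

lemma near_commutator_right:
  assumes "H #> a = H #> b" "a \<in> carrier G" "b \<in> carrier G" "g \<in> carrier G"
  shows "near G H 1 (commutator G g a) (commutator G g b)"
  using near_inv[OF near_commutator_left[OF assms]] assms by (simp add: word_simps)

lemma near_conj_one:
  assumes "near G H n x \<one>" "g \<in> carrier G"
  shows "near G H n (g \<otimes> x \<otimes> inv g) \<one>"
  using near_conj[OF assms] assms by simp

lemma near_commutator_of_kernel:
  assumes "w \<in> H" "h \<in> carrier G"
  shows "near G H 1 (commutator G h w) \<one>"
  using assms product_lengths_1[OF mixed_commutators_closed, of "commutator G h w"]
  by (auto simp: near_def mixed_commutators_def with_inverses_def)

text \<open>
  The typical case is that \<open>a\<close> and \<open>d\<close> lie, modulo the normal subgroup, in an abelian group on which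
  \<open>h\<close> acts by doubling. Then the hypotheses say in additive notation that \<open>p\<close> is \<open>3a\<close> and that \<open>q\<close>,
  the conjugate of \<open>d\<close> by \<open>h\<close>, is \<open>2d\<close>. For the commutator pairing \<open>B\<close> this gives
  \<open>B(p, q) = B(4a, 2d) - B(a, 2d) = B(2a, d) - B(a, 2d) = 0\<close>: the second equality is
  conjugation by \<open>h\<close>, and the last is \<open>swap_commutators\<close>. The three mixed commutators come from
  rewriting \<open>p\<close>, from rewriting \<open>q\<close>, and from conjugating by \<open>h\<close>.
\<close>

lemma near_commutator_by_scaling:
  assumes carr: "p \<in> carrier G" "h \<in> carrier G" "a \<in> carrier G" "d \<in> carrier G"
    and q: "q = h \<otimes> d \<otimes> inv h"
    and p: "H #> p = H #> (inv a \<otimes> (h \<otimes> (a \<otimes> d \<otimes> a \<otimes> inv d) \<otimes> inv h))"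
    and q': "H #> q = H #> (d \<otimes> a \<otimes> d \<otimes> inv a)"
    and w: "commutator G a (d \<otimes> a \<otimes> d \<otimes> inv a) \<in> H"
  shows "near G H 3 (commutator G p q) \<one>"
proof -
  define w where "w = commutator G a (d \<otimes> a \<otimes> d \<otimes> inv a)"
  let ?p = "inv a \<otimes> (h \<otimes> (a \<otimes> d \<otimes> a \<otimes> inv d) \<otimes> inv h)"
  let ?q = "d \<otimes> a \<otimes> d \<otimes> inv a"
  let ?c = "inv a \<otimes> (h \<otimes> w \<otimes> inv h) \<otimes> a"
  have wc: "w \<in> carrier G" and qc: "q \<in> carrier G" using carr by (auto simp: w_def q)
  have 1: "near G H 1 (commutator G p q) (commutator G ?p q)"
    using p carr qc by (intro near_commutator_left) auto
  \<comment> \<open>By \<open>swap_commutators\<close> the part of \<open>?p\<close> conjugated by \<open>h\<close> contributes the same \<open>w\<close> that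
    \<open>inv a\<close> contributes once \<open>q\<close> is replaced by \<open>?q\<close>.\<close>
  have 2: "commutator G ?p q = ?c \<otimes> commutator G (inv a) q"
    unfolding w_def swap_commutators[OF carr(3,4), symmetric] q
    using carr by (simp add: word_simps)
  have 3: "near G H 1 (?c \<otimes> commutator G (inv a) q) (?c \<otimes> commutator G (inv a) ?q)"
    using q' carr qc wc by (intro near_mult_left near_commutator_right) auto
  have 4: "?c \<otimes> commutator G (inv a) ?q = inv a \<otimes> commutator G h w \<otimes> inv (inv a)"
    using carr by (simp add: w_def word_simps)
  have 5: "near G H 1 (inv a \<otimes> commutator G h w \<otimes> inv (inv a)) \<one>"
    using assms(8) carr unfolding w_def[symmetric]
    by (intro near_conj_one near_commutator_of_kernel) auto
  show ?thesis
    using near_trans[OF near_trans[OF 1[unfolded 2] 3, unfolded 4] 5]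
    by (simp add: eval_nat_numeral)
qed

text \<open>
  If the class of \<open>c\<close> commutes with those of \<open>l\<close> and \<open>q\<close>, then conjugation by \<open>c\<close> changes each entry of
  \<open>[l, q]\<close> only by an element of the normal subgroup.
\<close>

lemma near_commutator_central:
  assumes carr: "c \<in> carrier G" "l \<in> carrier G" "q \<in> carrier G"
    and q: "H #> q = H #> commutator G l q"
    and cl: "H #> (c \<otimes> l \<otimes> inv c) = H #> l"
    and cq: "H #> (c \<otimes> q \<otimes> inv c) = H #> q"
  shows "near G H 3 (commutator G c q) \<one>"
proof -
  let ?p = "commutator G l q"
  have 1: "near G H 1 (commutator G c q) (commutator G c ?p)"
    using carr q by (intro near_commutator_right) auto
  have "near G H 1 (commutator G (c \<otimes> l \<otimes> inv c) (c \<otimes> q \<otimes> inv c)) (commutator G l (c \<otimes> q \<otimes> inv c))"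
    using carr cl by (intro near_commutator_left) auto
  moreover have "near G H 1 (commutator G l (c \<otimes> q \<otimes> inv c)) ?p"
    using carr cq by (intro near_commutator_right) auto
  ultimately have "near G H 2 (commutator G (c \<otimes> l \<otimes> inv c) (c \<otimes> q \<otimes> inv c)) ?p"
    using near_trans by (metis one_add_one)
  then have "near G H 2 (commutator G (c \<otimes> l \<otimes> inv c) (c \<otimes> q \<otimes> inv c) \<otimes> inv ?p) (?p \<otimes> inv ?p)"
    using carr by (intro near_mult_right) auto
  moreover have "commutator G (c \<otimes> l \<otimes> inv c) (c \<otimes> q \<otimes> inv c) \<otimes> inv ?p = commutator G c ?p"
    using carr by (simp add: word_simps)
  ultimately have 2: "near G H 2 (commutator G c ?p) \<one>" using carr by simp
  from near_trans[OF 1 2] show ?thesis by (simp add: eval_nat_numeral)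
qed

end

section \<open>Homomorphisms out of free groups\<close>

text \<open>
  The value of a word, not necessarily reduced, when each letter \<open>x\<close> is replaced by \<open>\<phi> x\<close>. On reduced
  words it is the homomorphism given by the universal property of the free group.
\<close>

definition word_eval :: "('a, 'b) monoid_scheme \<Rightarrow> ('x \<Rightarrow> 'a) \<Rightarrow> 'x word \<Rightarrow> 'a" where
  "word_eval G \<phi> w =
     foldr (\<lambda>(x, b) y. (if b then \<phi> x else inv\<^bsub>G\<^esub> (\<phi> x)) \<otimes>\<^bsub>G\<^esub> y) w \<one>\<^bsub>G\<^esub>"

lemma word_eval_simps [simp]:
  "word_eval G \<phi> [] = \<one>\<^bsub>G\<^esub>"
  "word_eval G \<phi> ((x, b) # w) = (if b then \<phi> x else inv\<^bsub>G\<^esub> (\<phi> x)) \<otimes>\<^bsub>G\<^esub> word_eval G \<phi> w"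
  by (simp_all add: word_eval_def)

context group
begin

lemma word_eval_closed:
  "\<phi> ` X \<subseteq> carrier G \<Longrightarrow> set w \<subseteq> X \<times> UNIV \<Longrightarrow> word_eval G \<phi> w \<in> carrier G"
  by (induction w) (auto split: prod.splits)

lemma word_eval_append:
  "\<phi> ` X \<subseteq> carrier G \<Longrightarrow> set v \<subseteq> X \<times> UNIV \<Longrightarrow> set w \<subseteq> X \<times> UNIV \<Longrightarrow>
    word_eval G \<phi> (v @ w) = word_eval G \<phi> v \<otimes> word_eval G \<phi> w"
  by (induction v) (auto simp: word_eval_closed image_subset_iff m_assoc)

lemma word_eval_cancel_cons:
  assumes "\<phi> ` X \<subseteq> carrier G" "set (a # w) \<subseteq> X \<times> UNIV"
  shows "word_eval G \<phi> (cancel_cons a w) = word_eval G \<phi> (a # w)"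
proof (cases w)
  case (Cons b v)
  obtain x i y j where [simp]: "a = (x, i)" "b = (y, j)" by fastforce
  have "\<phi> x \<in> carrier G" "word_eval G \<phi> v \<in> carrier G"
    using assms Cons word_eval_closed[OF assms(1), of v] by auto
  then show ?thesis
    using Cons by (cases i; cases j) (auto simp: opposite_def inv_mult_cancel_left mult_inv_cancel_left)
qed simp

lemma word_eval_reduce:
  assumes "\<phi> ` X \<subseteq> carrier G" "set w \<subseteq> X \<times> UNIV"
  shows "word_eval G \<phi> (reduce w) = word_eval G \<phi> w"
  using assms(2)
proof (induction w)
  case (Cons a w)
  have "set (a # reduce w) \<subseteq> X \<times> UNIV" using Cons.prems set_reduce[of w] by auto
  from word_eval_cancel_cons[OF assms(1) this] Cons show ?case
    by (cases a) (simp add: reduce_def)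
qed (simp add: reduce_def)

lemma word_eval_hom:
  "\<phi> ` X \<subseteq> carrier G \<Longrightarrow> word_eval G \<phi> \<in> hom (free_group X) G"
  by (rule homI) (auto simp: free_group_def word_eval_closed word_eval_append word_eval_reduce)

end

lemma free_group_letter_closed: "x \<in> X \<Longrightarrow> [(x, b)] \<in> carrier (free_group X)"
  by (simp add: free_group_def reduced_def)

lemma free_group_inv_letter:
  assumes "x \<in> X"
  shows "inv\<^bsub>free_group X\<^esub> [(x, True)] = [(x, False)]"
proof -
  interpret group "free_group X" by (rule group_free_group)
  have "[(x, False)] \<otimes>\<^bsub>free_group X\<^esub> [(x, True)] = \<one>\<^bsub>free_group X\<^esub>"
    by (simp add: free_group_def reduce_def opposite_def)
  with assms show ?thesis by (simp add: inv_equality free_group_letter_closed)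
qed

lemma hom_eq_on_free_group:
  assumes "f \<in> hom (free_group X) G" "f' \<in> hom (free_group X) G" "group G"
    and eq: "\<And>x. x \<in> X \<Longrightarrow> f [(x, True)] = f' [(x, True)]"
    and "w \<in> carrier (free_group X)"
  shows "f w = f' w"
  using assms(5)
proof (induction w)
  interpret f: group_hom "free_group X" G f
    using assms group_free_group by (simp add: group_hom_def group_hom_axioms_def)
  interpret f': group_hom "free_group X" G f'
    using assms group_free_group by (simp add: group_hom_def group_hom_axioms_def)
  {
    case Nil
    show ?case using f.hom_one f'.hom_one by (simp add: free_group_def)
  next
    case (Cons a w)
    obtain x b where a: "a = (x, b)" by fastforce
    have w: "w \<in> carrier (free_group X)" and x: "x \<in> X" and red: "reduced (a # w)"
      using Cons.prems a by (auto simp: free_group_def dest: reduced_ConsD)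
    have "a # w = [a] \<otimes>\<^bsub>free_group X\<^esub> w"
      using reduce_reduced[OF red] by (simp add: free_group_def)
    moreover have "f [a] = f' [a]"
    proof (cases b)
      case False
      then have "[a] = inv\<^bsub>free_group X\<^esub> [(x, True)]" using a x by (simp add: free_group_inv_letter)
      then show ?thesis using x eq by (simp add: free_group_letter_closed)
    qed (use a x eq in simp)
    ultimately show ?case
      using Cons.IH[OF w] w x a by (simp add: free_group_letter_closed)
  }
qed

section \<open>Consequences of the Steinberg relations\<close>

lemma (in group) conj_comp:
  assumes "g \<otimes> x \<otimes> inv g = y" "h \<otimes> y \<otimes> inv h = z"
    "g \<in> carrier G" "h \<in> carrier G" "x \<in> carrier G"
  shows "(h \<otimes> g) \<otimes> x \<otimes> inv (h \<otimes> g) = z"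
  using assms(3-5) by (simp flip: assms(1,2) add: word_simps)

lemma (in group) conj_inv:
  assumes "g \<otimes> x \<otimes> inv g = y" "g \<in> carrier G" "x \<in> carrier G"
  shows "inv g \<otimes> y \<otimes> inv (inv g) = x"
  using assms(2,3) by (simp flip: assms(1) add: word_simps)

text \<open>
  Premises \<open>\<alpha> \<in> {1, -1}\<close> discharge side conditions as they stand; \<open>insert_iff\<close>, which would split them
  into cases, is therefore removed from the simplifier below.
\<close>

lemma minus_sign [simp]: "\<alpha> \<in> {1, -1} \<Longrightarrow> - \<alpha> \<in> {1, -1 :: int}"
  by auto

text \<open>
  A group with elements \<open>X \<alpha> t\<close> that satisfy the relations of the standard presentation. They are
  imposed only for \<open>\<alpha> = \<plusminus>1\<close>.
\<close>

locale steinberg_relations = group Q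
  for Q :: "('a, 'b) monoid_scheme" (structure) +
  fixes X :: "int \<Rightarrow> 'k::field \<Rightarrow> 'a"
  assumes X_closed [simp]: "\<alpha> \<in> {1, -1} \<Longrightarrow> X \<alpha> t \<in> carrier Q"
    and X_add: "\<alpha> \<in> {1, -1} \<Longrightarrow> X \<alpha> (s + t) = X \<alpha> t \<otimes> X \<alpha> s"
    and X_weyl: "\<alpha> \<in> {1, -1} \<Longrightarrow> u \<noteq> 0 \<Longrightarrow> w = X \<alpha> u \<otimes> X (-\<alpha>) (- inverse u) \<otimes> X \<alpha> u \<Longrightarrow>
      w \<otimes> X \<alpha> t \<otimes> inv w = inv (X (-\<alpha>) (inverse (u\<^sup>2) * t))"
begin

lemma X_mult: "\<alpha> \<in> {1, -1} \<Longrightarrow> X \<alpha> s \<otimes> X \<alpha> t = X \<alpha> (s + t)"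
  using X_add[of \<alpha> t s] by (simp add: add.commute)

lemma X_zero: "\<alpha> \<in> {1, -1} \<Longrightarrow> X \<alpha> 0 = \<one>"
  using X_mult[of \<alpha> 0 0] X_closed[of \<alpha> 0] by (metis add_0 r_cancel_one')

lemma X_inv: "\<alpha> \<in> {1, -1} \<Longrightarrow> inv (X \<alpha> t) = X \<alpha> (- t)"
  using X_mult[of \<alpha> "- t" t] by (intro inv_equality) (auto simp: X_zero)

text \<open>The element \<open>w\<^sub>\<alpha>(u)\<close>.\<close>

definition weyl :: "int \<Rightarrow> 'k \<Rightarrow> 'a" where
  "weyl \<alpha> u = X \<alpha> u \<otimes> X (-\<alpha>) (- inverse u) \<otimes> X \<alpha> u"

lemma weyl_closed [simp]: "\<alpha> \<in> {1, -1} \<Longrightarrow> weyl \<alpha> u \<in> carrier Q"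
  by (simp add: weyl_def del: insert_iff)

lemma weyl_inv: "\<alpha> \<in> {1, -1} \<Longrightarrow> inv (weyl \<alpha> u) = weyl \<alpha> (- u)"
  by (simp add: weyl_def inv_mult_group X_inv m_assoc del: insert_iff)

lemma weyl_conj:
  assumes "\<alpha> \<in> {1, -1}" "u \<noteq> 0"
  shows "weyl \<alpha> u \<otimes> X \<alpha> t \<otimes> inv (weyl \<alpha> u) = X (-\<alpha>) (- (t / u\<^sup>2))"
  using X_weyl[OF assms weyl_def] assms by (simp add: X_inv divide_inverse mult.commute del: insert_iff)

text \<open>This is \<open>weyl_conj\<close> for \<open>-u\<close>, read backwards, because \<open>w\<^sub>\<alpha>(-u)\<close> is the inverse of \<open>w\<^sub>\<alpha>(u)\<close>.\<close>

lemma weyl_conj_opposite: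
  assumes "\<alpha> \<in> {1, -1}" "u \<noteq> 0"
  shows "weyl \<alpha> u \<otimes> X (-\<alpha>) t \<otimes> inv (weyl \<alpha> u) = X \<alpha> (- (u\<^sup>2 * t))"
proof -
  have "weyl \<alpha> (- u) \<otimes> X \<alpha> (- (u\<^sup>2 * t)) \<otimes> inv (weyl \<alpha> (- u)) = X (-\<alpha>) t"
    using weyl_conj[of \<alpha> "- u" "- (u\<^sup>2 * t)"] assms by (simp del: insert_iff)
  from conj_inv[OF this] assms show ?thesis by (simp add: weyl_inv del: insert_iff)
qed

text \<open>The element \<open>h\<^sub>\<alpha>(c) = w\<^sub>\<alpha>(c) w\<^sub>\<alpha>(-1)\<close>; it acts on the root subgroup of \<open>\<alpha>\<close> by \<open>c\<^sup>2\<close>.\<close>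

definition torus :: "int \<Rightarrow> 'k \<Rightarrow> 'a" where
  "torus \<alpha> c = weyl \<alpha> c \<otimes> weyl \<alpha> (- 1)"

lemma torus_closed [simp]: "\<alpha> \<in> {1, -1} \<Longrightarrow> torus \<alpha> c \<in> carrier Q"
  by (simp add: torus_def del: insert_iff)

context
  fixes c :: 'k
  assumes c: "c\<^sup>2 = 2" and two: "(2::'k) \<noteq> 0"
begin

lemma c_nonzero: "c \<noteq> 0"
  using c two by auto

lemma torus_conj:
  assumes "\<alpha> \<in> {1, -1}"
  shows "torus \<alpha> c \<otimes> X \<alpha> t \<otimes> inv (torus \<alpha> c) = X \<alpha> (2 * t)"
  unfolding torus_def using weyl_conj[of \<alpha> "-1" t] weyl_conj_opposite[of \<alpha> c "- t"] assms c c_nonzero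
  by (intro conj_comp[where y = "X (-\<alpha>) (- t)"]) (simp_all del: insert_iff)

lemma torus_conj_opposite:
  assumes "\<alpha> \<in> {1, -1}"
  shows "torus \<alpha> c \<otimes> X (-\<alpha>) t \<otimes> inv (torus \<alpha> c) = X (-\<alpha>) (t / 2)"
  unfolding torus_def using weyl_conj_opposite[of \<alpha> "-1" t] weyl_conj[of \<alpha> c "- t"] assms c c_nonzero
  by (intro conj_comp[where y = "X \<alpha> (- t)"]) (simp_all del: insert_iff)

lemma twisted_torus_conj:
  assumes "\<alpha> \<in> {1, -1}" "u \<noteq> 0" and k: "k = weyl \<alpha> u \<otimes> torus \<alpha> c \<otimes> inv (weyl \<alpha> u)"
  shows "k \<otimes> X \<alpha> t \<otimes> inv k = X \<alpha> (t / 2)"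
    and "k \<otimes> X (-\<alpha>) t \<otimes> inv k = X (-\<alpha>) (2 * t)"
proof -
  have "inv (weyl \<alpha> u) \<otimes> X \<alpha> t \<otimes> inv (inv (weyl \<alpha> u)) = X (-\<alpha>) (- (t / u\<^sup>2))"
    using weyl_conj[of \<alpha> "- u" t] assms by (simp add: weyl_inv del: insert_iff)
  moreover have "(weyl \<alpha> u \<otimes> torus \<alpha> c) \<otimes> X (-\<alpha>) (- (t / u\<^sup>2)) \<otimes> inv (weyl \<alpha> u \<otimes> torus \<alpha> c) = X \<alpha> (t / 2)"
    using torus_conj_opposite[of \<alpha> "- (t / u\<^sup>2)"] weyl_conj_opposite[of \<alpha> u "- (t / u\<^sup>2) / 2"] assms
    by (intro conj_comp[where y = "X (-\<alpha>) (- (t / u\<^sup>2) / 2)"]) (simp_all del: insert_iff)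
  ultimately show "k \<otimes> X \<alpha> t \<otimes> inv k = X \<alpha> (t / 2)"
    unfolding k by (rule conj_comp) (use assms(1) in \<open>simp_all del: insert_iff\<close>)
  have "inv (weyl \<alpha> u) \<otimes> X (-\<alpha>) t \<otimes> inv (inv (weyl \<alpha> u)) = X \<alpha> (- (u\<^sup>2 * t))"
    using weyl_conj_opposite[of \<alpha> "- u" t] assms by (simp add: weyl_inv del: insert_iff)
  moreover have "(weyl \<alpha> u \<otimes> torus \<alpha> c) \<otimes> X \<alpha> (- (u\<^sup>2 * t)) \<otimes> inv (weyl \<alpha> u \<otimes> torus \<alpha> c) = X (-\<alpha>) (2 * t)"
    using torus_conj[of \<alpha> "- (u\<^sup>2 * t)"] weyl_conj[of \<alpha> u "2 * - (u\<^sup>2 * t)"] assms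
    by (intro conj_comp[where y = "X \<alpha> (2 * - (u\<^sup>2 * t))"]) (simp_all del: insert_iff)
  ultimately show "k \<otimes> X (-\<alpha>) t \<otimes> inv k = X (-\<alpha>) (2 * t)"
    unfolding k by (rule conj_comp) (use assms(1) in \<open>simp_all del: insert_iff\<close>)
qed

text \<open>
  The elements \<open>h\<^bsub>-\<alpha>\<^esub>(c)\<close> and \<open>k\<close> act in the same way on both root subgroups, although they may differ
  (by a Steinberg symbol); so their quotient \<open>z\<close> commutes with everything that the root subgroups
  generate.
\<close>

lemma torus_defect_central:
  assumes "\<alpha> \<in> {1, -1}" "u \<noteq> 0" and k: "k = weyl \<alpha> u \<otimes> torus \<alpha> c \<otimes> inv (weyl \<alpha> u)"
    and z: "z = inv (torus (-\<alpha>) c) \<otimes> k"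
  shows "\<beta> \<in> {1, -1} \<Longrightarrow> z \<otimes> X \<beta> t \<otimes> inv z = X \<beta> t"
    and "\<beta> \<in> {1, -1} \<Longrightarrow> z \<otimes> torus \<beta> c \<otimes> inv z = torus \<beta> c"
proof -
  have kc: "k \<in> carrier Q" and zc: "z \<in> carrier Q" using assms by (simp_all del: insert_iff)
  have z1: "z \<otimes> X \<alpha> t \<otimes> inv z = X \<alpha> t" for t
    unfolding z using twisted_torus_conj(1)[OF assms(1-3)]
      conj_inv[OF torus_conj_opposite[of "-\<alpha>" t]] assms(1) kc
    by (intro conj_comp[where y = "X \<alpha> (t / 2)"]) (simp_all del: insert_iff)
  have z2: "z \<otimes> X (-\<alpha>) t \<otimes> inv z = X (-\<alpha>) t" for t
    unfolding z using twisted_torus_conj(2)[OF assms(1-3)]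
      conj_inv[OF torus_conj[of "-\<alpha>" t]] assms(1) kc
    by (intro conj_comp[where y = "X (-\<alpha>) (2 * t)"]) (simp_all del: insert_iff)
  show zX: "z \<otimes> X \<beta> t \<otimes> inv z = X \<beta> t" if "\<beta> \<in> {1, -1}" for \<beta> t
  proof -
    have "\<beta> = \<alpha> \<or> \<beta> = -\<alpha>" using that assms(1) by auto
    then show ?thesis using z1 z2 by blast
  qed
  show "z \<otimes> torus \<beta> c \<otimes> inv z = torus \<beta> c" if "\<beta> \<in> {1, -1}" for \<beta>
  proof -
    interpret conj: group_hom Q Q "\<lambda>x. z \<otimes> x \<otimes> inv z" by (rule conjugation_hom) fact
    show ?thesis
      unfolding torus_def weyl_def using that zX[of "-\<beta>"] zX[of \<beta>]
      by (simp only: conj.hom_mult X_closed m_closed minus_sign)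
  qed
qed

end

end

section \<open>The standard presentation\<close>

lemma group_st_free: "group (st_free :: (int \<times> 'k::field) word monoid)"
  unfolding st_free_def by (rule group_free_group)

interpretation st_free: group "st_free :: (int \<times> 'k::field) word monoid"
  by (rule group_st_free)

lemma st_x_closed [simp]: "\<alpha> \<in> {1, -1} \<Longrightarrow> st_x \<alpha> t \<in> carrier st_free"
  unfolding st_free_def st_x_def by (rule free_group_letter_closed) simp

lemma st_w_closed [simp]: "\<alpha> \<in> {1, -1} \<Longrightarrow> st_w \<alpha> u \<in> carrier st_free"
  by (simp add: st_w_def del: insert_iff)

lemma st_r1_closed: "\<alpha> \<in> {1, -1} \<Longrightarrow> st_r1 \<alpha> s t \<in> carrier st_free"
  by (simp add: st_r1_def del: insert_iff)

lemma st_r2_closed: "\<alpha> \<in> {1, -1} \<Longrightarrow> st_r2 \<alpha> u t \<in> carrier st_free"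
  by (simp add: st_r2_def del: insert_iff)

lemma st_S_closed: "st_S \<subseteq> carrier st_free"
  unfolding st_S_def by (auto intro!: st_r1_closed st_r2_closed)

interpretation st_R: normal "st_R :: (int \<times> 'k::field) word set" st_free
  unfolding st_R_def by (rule st_free.normal_normal_closure[OF st_S_closed])

lemma st_r1_in_st_S: "\<alpha> \<in> {1, -1} \<Longrightarrow> st_r1 \<alpha> s t \<in> st_S"
  unfolding st_S_def
  by (rule UnI1, rule CollectI, rule exI[of _ \<alpha>], rule exI[of _ s], rule exI[of _ t]) simp

lemma st_r2_in_st_S: "\<alpha> \<in> {1, -1} \<Longrightarrow> u \<noteq> 0 \<Longrightarrow> st_r2 \<alpha> u t \<in> st_S"
  unfolding st_S_def
  by (rule UnI2, rule CollectI, rule exI[of _ \<alpha>], rule exI[of _ u], rule exI[of _ t]) simp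

lemma st_S_subset_st_R: "st_S \<subseteq> st_R"
  unfolding st_R_def normal_closure_def by blast

abbreviation steinberg_class :: "(int \<times> 'k::field) word \<Rightarrow> (int \<times> 'k) word set" where
  "steinberg_class x \<equiv> st_R #>\<^bsub>st_free\<^esub> x"

interpretation quot: group_hom "st_free :: (int \<times> 'k::field) word monoid" steinberg steinberg_class
  unfolding steinberg_def
  using st_R.r_coset_hom_Mod st_R.factorgroup_is_group group_st_free
  by (simp add: group_hom_def group_hom_axioms_def)

lemma steinberg_class_eq_one_iff:
  "x \<in> carrier st_free \<Longrightarrow> steinberg_class x = \<one>\<^bsub>steinberg\<^esub> \<longleftrightarrow> x \<in> st_R"
  using st_free.coset_join1[OF _ _ st_R.subgroup_axioms, of x]
    st_free.coset_join2[OF _ st_R.subgroup_axioms, of x]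
  by (auto simp: steinberg_def FactGroup_def)

interpretation st: steinberg_relations steinberg
  "\<lambda>\<alpha> (t :: 'k::field). steinberg_class (st_x \<alpha> t)"
proof
  fix \<alpha> :: int and s t :: 'k
  assume \<alpha>: "\<alpha> \<in> {1, -1}"
  note [simp del] = insert_iff and [simp] = \<alpha>
  show "steinberg_class (st_x \<alpha> t) \<in> carrier steinberg" by simp
  have "st_r1 \<alpha> s t \<in> st_R" using st_S_subset_st_R st_r1_in_st_S[OF \<alpha>] by (rule subsetD)
  then have "steinberg_class (st_r1 \<alpha> s t) = \<one>\<^bsub>steinberg\<^esub>"
    by (simp add: steinberg_class_eq_one_iff st_r1_closed)
  then show "steinberg_class (st_x \<alpha> (s + t))
      = steinberg_class (st_x \<alpha> t) \<otimes>\<^bsub>steinberg\<^esub> steinberg_class (st_x \<alpha> s)"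
    by (simp add: st_r1_def quot.H.inv_solve_right' quot.H.m_assoc flip: quot.H.inv_mult_group)
next
  fix \<alpha> :: int and u t :: 'k and w
  assume \<alpha>: "\<alpha> \<in> {1, -1}" and u: "u \<noteq> 0"
    and w: "w = steinberg_class (st_x \<alpha> u) \<otimes>\<^bsub>steinberg\<^esub> steinberg_class (st_x (- \<alpha>) (- inverse u))
        \<otimes>\<^bsub>steinberg\<^esub> steinberg_class (st_x \<alpha> u)"
  note [simp del] = insert_iff and [simp] = \<alpha>
  have "st_r2 \<alpha> u t \<in> st_R" using st_S_subset_st_R st_r2_in_st_S[OF \<alpha> u] by (rule subsetD)
  then have "steinberg_class (st_r2 \<alpha> u t) = \<one>\<^bsub>steinberg\<^esub>"
    by (simp add: steinberg_class_eq_one_iff st_r2_closed)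
  then have "w \<otimes>\<^bsub>steinberg\<^esub> steinberg_class (st_x \<alpha> t) \<otimes>\<^bsub>steinberg\<^esub> inv\<^bsub>steinberg\<^esub> w
      \<otimes>\<^bsub>steinberg\<^esub> steinberg_class (st_x (- \<alpha>) (inverse (u\<^sup>2) * t)) = \<one>\<^bsub>steinberg\<^esub>"
    by (simp add: st_r2_def st_w_def w)
  then show "w \<otimes>\<^bsub>steinberg\<^esub> steinberg_class (st_x \<alpha> t) \<otimes>\<^bsub>steinberg\<^esub> inv\<^bsub>steinberg\<^esub> w
      = inv\<^bsub>steinberg\<^esub> steinberg_class (st_x (- \<alpha>) (inverse (u\<^sup>2) * t))"
    by (intro quot.H.inv_equality[symmetric]) (simp_all add: w)
qed

text \<open>The word \<open>h\<^sub>\<alpha>(c) = w\<^sub>\<alpha>(c) w\<^sub>\<alpha>(-1)\<close> in the free group.\<close>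

definition st_h :: "int \<Rightarrow> 'k::field \<Rightarrow> (int \<times> 'k) word" where
  "st_h \<alpha> c = st_w \<alpha> c \<otimes>\<^bsub>st_free\<^esub> st_w \<alpha> (- 1)"

lemma st_h_closed [simp]: "\<alpha> \<in> {1, -1} \<Longrightarrow> st_h \<alpha> c \<in> carrier st_free"
  by (simp add: st_h_def del: insert_iff)

lemma steinberg_class_st_w:
  "\<alpha> \<in> {1, -1} \<Longrightarrow> steinberg_class (st_w \<alpha> u) = st.weyl \<alpha> u"
  by (simp add: st_w_def st.weyl_def del: insert_iff)

lemma steinberg_class_st_h:
  "\<alpha> \<in> {1, -1} \<Longrightarrow> steinberg_class (st_h \<alpha> c) = st.torus \<alpha> c"
  by (simp add: st_h_def st.torus_def steinberg_class_st_w del: insert_iff)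

section \<open>The endomorphism that splits the extension\<close>

context
  fixes c :: "'k::field"
  assumes c: "c\<^sup>2 = 2" and six: "(6::'k) \<noteq> 0"
begin

lemma two_nonzero: "(2::'k) \<noteq> 0" and three_nonzero: "(3::'k) \<noteq> 0"
proof -
  have "(6::'k) = 2 * 3" by simp
  with six show "(2::'k) \<noteq> 0" "(3::'k) \<noteq> 0" by (metis mult_zero_left mult_zero_right)+
qed

lemma near_commutator_root_subgroup:
  assumes \<alpha>: "\<alpha> \<in> {1, -1}" and pq: "p \<in> carrier st_free" "q \<in> carrier st_free"
    and p: "steinberg_class p = steinberg_class (st_x \<alpha> s)"
    and q: "steinberg_class q = steinberg_class (st_x \<alpha> (t::'k))"
  shows "near st_free st_R 3 (commutator st_free p q) \<one>\<^bsub>st_free\<^esub>"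
proof -
  note [simp del] = insert_iff and [simp] = \<alpha> pq
  define s' t' where "s' = s / 3" "t' = t / 2"
  have st: "s = 3 * s'" "t = 2 * t'"
    unfolding \<open>s' = s / 3\<close> \<open>t' = t / 2\<close> using two_nonzero three_nonzero by simp_all
  define a where "a = st_x \<alpha> s'"
  define h where "h = st_h \<alpha> c"
  define d where "d = inv\<^bsub>st_free\<^esub> h \<otimes>\<^bsub>st_free\<^esub> q \<otimes>\<^bsub>st_free\<^esub> h"
  have [simp]: "a \<in> carrier st_free" "h \<in> carrier st_free" "d \<in> carrier st_free"
    by (simp_all add: a_def h_def d_def)
  have h: "steinberg_class h = st.torus \<alpha> c" by (simp add: h_def steinberg_class_st_h)
  have d: "steinberg_class d = steinberg_class (st_x \<alpha> t')"
    using quot.H.conj_inv[OF st.torus_conj[OF c two_nonzero \<alpha>, of t']]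
    by (simp add: d_def h q st(2))
  show ?thesis
  proof (rule st_R.near_commutator_by_scaling[of p h a d])
    show "q = h \<otimes>\<^bsub>st_free\<^esub> d \<otimes>\<^bsub>st_free\<^esub> inv\<^bsub>st_free\<^esub> h"
      by (simp add: d_def st_free.word_simps)
    show "steinberg_class p = steinberg_class (inv\<^bsub>st_free\<^esub> a \<otimes>\<^bsub>st_free\<^esub>
        (h \<otimes>\<^bsub>st_free\<^esub> (a \<otimes>\<^bsub>st_free\<^esub> d \<otimes>\<^bsub>st_free\<^esub> a \<otimes>\<^bsub>st_free\<^esub> inv\<^bsub>st_free\<^esub> d) \<otimes>\<^bsub>st_free\<^esub> inv\<^bsub>st_free\<^esub> h))"
      by (simp add: p h d a_def st.X_mult st.X_inv st.torus_conj[OF c two_nonzero] st(1))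
    show "steinberg_class q
        = steinberg_class (d \<otimes>\<^bsub>st_free\<^esub> a \<otimes>\<^bsub>st_free\<^esub> d \<otimes>\<^bsub>st_free\<^esub> inv\<^bsub>st_free\<^esub> a)"
      by (simp add: q d a_def st.X_mult st.X_inv st(2))
    show "commutator st_free a (d \<otimes>\<^bsub>st_free\<^esub> a \<otimes>\<^bsub>st_free\<^esub> d \<otimes>\<^bsub>st_free\<^esub> inv\<^bsub>st_free\<^esub> a) \<in> st_R"
      by (subst steinberg_class_eq_one_iff[symmetric])
        (simp_all add: commutator_def d a_def st.X_mult st.X_inv st.X_zero)
  qed simp_all
qed

text \<open>
  The image of the generator \<open>x\<^sub>\<alpha>(t)\<close> under the splitting: \<open>[h\<^sub>1, x\<^sub>1(t)]\<close> for \<open>\<alpha> = 1\<close> and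
  \<open>[x\<^bsub>-1\<^esub>(t)\<^sup>-\<^sup>1, h\<^bsub>-1\<^esub>]\<close> for \<open>\<alpha> = -1\<close>. Both are lifts of \<open>x\<^sub>\<alpha>(t)\<close>. As a Weyl element turns
  \<open>x\<^sub>1\<close> into the inverse of an \<open>x\<^bsub>-1\<^esub>\<close>, the different orders of the factors make the image of a Weyl
  relator collapse without a commutator of elements of one root subgroup.
\<close>

definition st_section :: "int \<times> 'k \<Rightarrow> (int \<times> 'k) word" where
  "st_section = (\<lambda>(\<alpha>, t).
     if \<alpha> = 1 then commutator st_free (st_h 1 c) (st_x 1 t)
     else commutator st_free (inv\<^bsub>st_free\<^esub> (st_x (- 1) t)) (st_h (- 1) c))"

lemma st_section_closed:
  "st_section ` ({1, -1} \<times> UNIV) \<subseteq> carrier st_free"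
  by (auto simp: st_section_def)

lemma steinberg_class_st_section:
  assumes "\<alpha> \<in> {1, -1}"
  shows "steinberg_class (st_section (\<alpha>, t)) = steinberg_class (st_x \<alpha> t)"
proof -
  note [simp del] = insert_iff
  consider "\<alpha> = 1" | "\<alpha> = -1" using assms by (auto simp: insert_iff)
  then show ?thesis
  proof cases
    case 1
    note [simp] = assms[unfolded 1]
    show ?thesis
      using st.torus_conj[OF c two_nonzero, of 1 t]
      by (simp add: 1 st_section_def commutator_def steinberg_class_st_h st.X_mult st.X_inv)
  next
    case 2
    note [simp] = assms[unfolded 2]
    have "steinberg_class (st_section (\<alpha>, t)) = steinberg_class (st_x (-1) (-t)) \<otimes>\<^bsub>steinberg\<^esub>
        (st.torus (-1) c \<otimes>\<^bsub>steinberg\<^esub> steinberg_class (st_x (-1) t) \<otimes>\<^bsub>steinberg\<^esub> inv\<^bsub>steinberg\<^esub> st.torus (-1) c)"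
      by (simp add: 2 st_section_def commutator_def steinberg_class_st_h st.X_inv quot.H.m_assoc)
    then show ?thesis
      using st.torus_conj[OF c two_nonzero, of "-1" t] by (simp add: 2 st.X_mult)
  qed
qed

text \<open>The endomorphism \<open>\<Phi>\<close> of the free group that extends \<open>st_section\<close>.\<close>

definition st_lift :: "(int \<times> 'k) word \<Rightarrow> (int \<times> 'k) word" where
  "st_lift = word_eval st_free st_section"

interpretation lift: group_hom st_free st_free st_lift
  using st_free.word_eval_hom[OF st_section_closed] group_st_free
  by (simp add: group_hom_def group_hom_axioms_def st_lift_def flip: st_free_def)

lemma st_lift_st_x: "\<alpha> \<in> {1, -1} \<Longrightarrow> st_lift (st_x \<alpha> t) = st_section (\<alpha>, t)"
  using st_section_closed by (auto simp: st_lift_def st_x_def image_subset_iff)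

lemma steinberg_class_st_lift:
  assumes "x \<in> carrier st_free"
  shows "steinberg_class (st_lift x) = steinberg_class x"
proof (rule hom_eq_on_free_group[where f = "\<lambda>x. steinberg_class (st_lift x)" and f' = steinberg_class
      and G = steinberg])
  show "(\<lambda>x. steinberg_class (st_lift x)) \<in> hom (free_group ({1, -1} \<times> UNIV)) steinberg"
    using hom_compose[OF lift.homh quot.homh] by (simp add: comp_def st_free_def)
  show "steinberg_class \<in> hom (free_group ({1, -1} \<times> UNIV)) steinberg"
    using quot.homh by (simp add: st_free_def)
  fix x :: "int \<times> 'k" assume "x \<in> {1, -1} \<times> UNIV"
  then show "steinberg_class (st_lift [(x, True)]) = steinberg_class [(x, True)]"
    using st_lift_st_x[of "fst x" "snd x"] steinberg_class_st_section[of "fst x" "snd x"]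
    by (cases x) (simp add: st_x_def)
qed (use assms quot.H.group_axioms in \<open>simp_all add: st_free_def\<close>)

section \<open>Images of the relators\<close>

lemma near_st_lift_r1:
  assumes \<alpha>: "\<alpha> \<in> {1, -1}"
  shows "near st_free st_R 4 (st_lift (st_r1 \<alpha> s t)) \<one>\<^bsub>st_free\<^esub>"
proof -
  note [simp del] = insert_iff and [simp] = \<alpha>
  define x a b l where "x = st_x \<alpha> (s + t)" "a = st_x \<alpha> t" "b = st_x \<alpha> s" "l = st_h \<alpha> c"
  note defs = this
  have [simp]: "x \<in> carrier st_free" "a \<in> carrier st_free" "b \<in> carrier st_free" "l \<in> carrier st_free"
    by (simp_all add: defs)
  have x: "steinberg_class x = steinberg_class (a \<otimes>\<^bsub>st_free\<^esub> b)"
    by (simp add: defs st.X_mult add.commute)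
  have lift: "st_lift (st_r1 \<alpha> s t) = st_section (\<alpha>, s + t) \<otimes>\<^bsub>st_free\<^esub>
      inv\<^bsub>st_free\<^esub> st_section (\<alpha>, s) \<otimes>\<^bsub>st_free\<^esub> inv\<^bsub>st_free\<^esub> st_section (\<alpha>, t)"
    by (simp add: st_r1_def st_lift_st_x)
  consider "\<alpha> = 1" | "\<alpha> = -1" using \<alpha> by (auto simp: insert_iff)
  then show ?thesis
  proof cases
    assume "\<alpha> = 1"
    note [simp] = \<alpha>[unfolded \<open>\<alpha> = 1\<close>]
    let ?p = "commutator st_free l b"
    let ?r = "inv\<^bsub>st_free\<^esub> commutator st_free l b \<otimes>\<^bsub>st_free\<^esub> inv\<^bsub>st_free\<^esub> commutator st_free l a"
    have 1: "st_lift (st_r1 \<alpha> s t) = commutator st_free l x \<otimes>\<^bsub>st_free\<^esub> ?r"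
      unfolding lift by (simp add: \<open>\<alpha> = 1\<close> defs st_section_def st_free.m_assoc)
    have 2: "near st_free st_R 1 (commutator st_free l x \<otimes>\<^bsub>st_free\<^esub> ?r)
        (commutator st_free l (a \<otimes>\<^bsub>st_free\<^esub> b) \<otimes>\<^bsub>st_free\<^esub> ?r)"
      by (intro st_R.near_mult_right st_R.near_commutator_right x) simp_all
    have 3: "commutator st_free l (a \<otimes>\<^bsub>st_free\<^esub> b) \<otimes>\<^bsub>st_free\<^esub> ?r
        = (l \<otimes>\<^bsub>st_free\<^esub> a \<otimes>\<^bsub>st_free\<^esub> inv\<^bsub>st_free\<^esub> l) \<otimes>\<^bsub>st_free\<^esub> commutator st_free ?p (inv\<^bsub>st_free\<^esub> a)
          \<otimes>\<^bsub>st_free\<^esub> inv\<^bsub>st_free\<^esub> (l \<otimes>\<^bsub>st_free\<^esub> a \<otimes>\<^bsub>st_free\<^esub> inv\<^bsub>st_free\<^esub> l)"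
      by (simp add: st_free.word_simps)
    have 4: "near st_free st_R 3 (commutator st_free ?p (inv\<^bsub>st_free\<^esub> a)) \<one>\<^bsub>st_free\<^esub>"
      using steinberg_class_st_section[of \<alpha> s]
      by (intro near_commutator_root_subgroup[of 1 _ _ s "- t"])
        (use \<alpha> in \<open>simp_all add: \<open>\<alpha> = 1\<close> defs st_section_def st.X_inv\<close>)
    from st_R.near_trans[OF 2[unfolded 3] st_R.near_conj_one[OF 4]] show ?thesis by (simp add: 1)
  next
    assume "\<alpha> = -1"
    note [simp] = \<alpha>[unfolded \<open>\<alpha> = -1\<close>]
    let ?p = "commutator st_free (inv\<^bsub>st_free\<^esub> a) l"
    let ?r = "inv\<^bsub>st_free\<^esub> commutator st_free (inv\<^bsub>st_free\<^esub> b) l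
      \<otimes>\<^bsub>st_free\<^esub> inv\<^bsub>st_free\<^esub> commutator st_free (inv\<^bsub>st_free\<^esub> a) l"
    have 1: "st_lift (st_r1 \<alpha> s t) = commutator st_free (inv\<^bsub>st_free\<^esub> x) l \<otimes>\<^bsub>st_free\<^esub> ?r"
      unfolding lift by (simp add: \<open>\<alpha> = -1\<close> defs st_section_def st_free.m_assoc)
    have 2: "near st_free st_R 1 (commutator st_free (inv\<^bsub>st_free\<^esub> x) l \<otimes>\<^bsub>st_free\<^esub> ?r)
        (commutator st_free (inv\<^bsub>st_free\<^esub> (a \<otimes>\<^bsub>st_free\<^esub> b)) l \<otimes>\<^bsub>st_free\<^esub> ?r)"
      by (intro st_R.near_mult_right st_R.near_commutator_left) (simp_all add: x)
    have 3: "commutator st_free (inv\<^bsub>st_free\<^esub> (a \<otimes>\<^bsub>st_free\<^esub> b)) l \<otimes>\<^bsub>st_free\<^esub> ?r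
        = \<one>\<^bsub>st_free\<^esub> \<otimes>\<^bsub>st_free\<^esub> commutator st_free (inv\<^bsub>st_free\<^esub> b) ?p \<otimes>\<^bsub>st_free\<^esub> inv\<^bsub>st_free\<^esub> \<one>\<^bsub>st_free\<^esub>"
      by (simp add: st_free.word_simps)
    have 4: "near st_free st_R 3 (commutator st_free (inv\<^bsub>st_free\<^esub> b) ?p) \<one>\<^bsub>st_free\<^esub>"
      using steinberg_class_st_section[of \<alpha> t]
      by (intro near_commutator_root_subgroup[of "-1" _ _ "- s" t])
        (use \<alpha> in \<open>simp_all add: \<open>\<alpha> = -1\<close> defs st_section_def st.X_inv\<close>)
    from st_R.near_trans[OF 2[unfolded 3] st_R.near_conj_one[OF 4]] show ?thesis by (simp add: 1)
  qed
qed

text \<open>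
  With \<open>q\<close> the conjugate of \<open>x\<^sub>\<alpha>(t)\<close> and \<open>k\<close> the conjugate of \<open>h\<^sub>\<alpha>\<close> by \<open>w\<^sub>\<alpha>(u)\<close>, and with \<open>l = h\<^bsub>-\<alpha>\<^esub>\<close>,
  two mixed commutators turn the image of the relator into a conjugate of
  \<open>(k q k\<^sup>-\<^sup>1) (l q l\<^sup>-\<^sup>1)\<^sup>-\<^sup>1\<close>, hence of \<open>[z, q]\<close> for \<open>z = l\<^sup>-\<^sup>1 k\<close>, whose class is central.
\<close>

lemma near_st_lift_r2:
  assumes \<alpha>: "\<alpha> \<in> {1, -1}" and u: "u \<noteq> 0"
  shows "near st_free st_R 5 (st_lift (st_r2 \<alpha> u t)) \<one>\<^bsub>st_free\<^esub>"
proof -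
  note [simp del] = insert_iff and [simp] = \<alpha>
  define w a y h l where "w = st_w \<alpha> u" "a = st_x \<alpha> t" "y = st_x (- \<alpha>) (inverse (u\<^sup>2) * t)"
    "h = st_h \<alpha> c" "l = st_h (- \<alpha>) c"
  note defs = this
  have [simp]: "w \<in> carrier st_free" "a \<in> carrier st_free" "y \<in> carrier st_free"
    "h \<in> carrier st_free" "l \<in> carrier st_free"
    by (simp_all add: defs)
  define q k z where "q = w \<otimes>\<^bsub>st_free\<^esub> a \<otimes>\<^bsub>st_free\<^esub> inv\<^bsub>st_free\<^esub> w"
    "k = w \<otimes>\<^bsub>st_free\<^esub> h \<otimes>\<^bsub>st_free\<^esub> inv\<^bsub>st_free\<^esub> w" "z = inv\<^bsub>st_free\<^esub> l \<otimes>\<^bsub>st_free\<^esub> k"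
  note qkz = this
  have [simp]: "q \<in> carrier st_free" "k \<in> carrier st_free" "z \<in> carrier st_free"
    by (simp_all add: qkz)
  let ?A = "st_section (\<alpha>, t)" and ?Y = "st_section (- \<alpha>, inverse (u\<^sup>2) * t)"
  have [simp]: "?A \<in> carrier st_free" "?Y \<in> carrier st_free"
    using st_section_closed \<alpha> minus_sign[OF \<alpha>] by blast+

  define v where "v = t / u\<^sup>2"
  have q: "steinberg_class q = steinberg_class (st_x (- \<alpha>) (- v))"
    using st.weyl_conj[OF \<alpha> u, of t] by (simp add: qkz defs steinberg_class_st_w v_def)
  have y: "steinberg_class y = steinberg_class (inv\<^bsub>st_free\<^esub> q)"
    by (simp add: q defs st.X_inv v_def divide_inverse mult.commute)
  have z: "steinberg_class z = inv\<^bsub>steinberg\<^esub> st.torus (- \<alpha>) c \<otimes>\<^bsub>steinberg\<^esub>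
      (st.weyl \<alpha> u \<otimes>\<^bsub>steinberg\<^esub> st.torus \<alpha> c \<otimes>\<^bsub>steinberg\<^esub> inv\<^bsub>steinberg\<^esub> st.weyl \<alpha> u)"
    by (simp add: qkz defs steinberg_class_st_w steinberg_class_st_h)
  note z_central = st.torus_defect_central[OF c two_nonzero \<alpha> u refl z minus_sign[OF \<alpha>]]
  have central: "near st_free st_R 3 (commutator st_free z q) \<one>\<^bsub>st_free\<^esub>"
  proof (rule st_R.near_commutator_central)
    have "steinberg_class (commutator st_free l q) = st.torus (- \<alpha>) c \<otimes>\<^bsub>steinberg\<^esub>
        steinberg_class (st_x (- \<alpha>) (- v)) \<otimes>\<^bsub>steinberg\<^esub> inv\<^bsub>steinberg\<^esub> st.torus (- \<alpha>) c
        \<otimes>\<^bsub>steinberg\<^esub> inv\<^bsub>steinberg\<^esub> steinberg_class (st_x (- \<alpha>) (- v))"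
      by (simp add: commutator_def q defs steinberg_class_st_h)
    then show "steinberg_class q = steinberg_class (commutator st_free l q)"
      by (simp add: st.torus_conj[OF c two_nonzero] st.X_inv st.X_mult q)
    show "steinberg_class (z \<otimes>\<^bsub>st_free\<^esub> l \<otimes>\<^bsub>st_free\<^esub> inv\<^bsub>st_free\<^esub> z) = steinberg_class l"
      using z_central(2) by (simp add: defs(5) steinberg_class_st_h)
    show "steinberg_class (z \<otimes>\<^bsub>st_free\<^esub> q \<otimes>\<^bsub>st_free\<^esub> inv\<^bsub>st_free\<^esub> z) = steinberg_class q"
      using z_central(1) by (simp add: q)
  qed simp_all

  have 1: "near st_free st_R 1 (st_lift (st_r2 \<alpha> u t))
      (w \<otimes>\<^bsub>st_free\<^esub> ?A \<otimes>\<^bsub>st_free\<^esub> inv\<^bsub>st_free\<^esub> w \<otimes>\<^bsub>st_free\<^esub> ?Y)"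
  proof -
    have "st_lift (st_r2 \<alpha> u t)
        = st_lift w \<otimes>\<^bsub>st_free\<^esub> ?A \<otimes>\<^bsub>st_free\<^esub> inv\<^bsub>st_free\<^esub> st_lift w \<otimes>\<^bsub>st_free\<^esub> ?Y"
      by (simp add: st_r2_def st_lift_st_x defs)
    then show ?thesis
      by (simp only:) (intro st_R.near_mult_right st_R.near_conj_cong, simp_all add: steinberg_class_st_lift)
  qed
  have 2: "\<exists>g\<in>carrier st_free. near st_free st_R 1
      (w \<otimes>\<^bsub>st_free\<^esub> ?A \<otimes>\<^bsub>st_free\<^esub> inv\<^bsub>st_free\<^esub> w \<otimes>\<^bsub>st_free\<^esub> ?Y)
      (g \<otimes>\<^bsub>st_free\<^esub> commutator st_free z q \<otimes>\<^bsub>st_free\<^esub> inv\<^bsub>st_free\<^esub> g)"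
  proof -
    consider "\<alpha> = 1" | "\<alpha> = -1" using \<alpha> by (auto simp: insert_iff)
    then show ?thesis
    proof cases
      case 1
      have AY: "?A = commutator st_free h a" "?Y = commutator st_free (inv\<^bsub>st_free\<^esub> y) l"
        by (simp_all add: 1 defs st_section_def)
      have "near st_free st_R 1 ?Y (commutator st_free q l)"
        unfolding AY by (intro st_R.near_commutator_left) (simp_all add: y)
      moreover have "w \<otimes>\<^bsub>st_free\<^esub> ?A \<otimes>\<^bsub>st_free\<^esub> inv\<^bsub>st_free\<^esub> w \<otimes>\<^bsub>st_free\<^esub> commutator st_free q l
          = l \<otimes>\<^bsub>st_free\<^esub> commutator st_free z q \<otimes>\<^bsub>st_free\<^esub> inv\<^bsub>st_free\<^esub> l"
        unfolding AY by (simp add: qkz st_free.word_simps)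
      ultimately show ?thesis
        using st_R.near_mult_left[of 1 ?Y "commutator st_free q l"
            "w \<otimes>\<^bsub>st_free\<^esub> ?A \<otimes>\<^bsub>st_free\<^esub> inv\<^bsub>st_free\<^esub> w"]
        by (intro bexI[of _ l]) simp_all
    next
      case 2
      let ?g = "inv\<^bsub>st_free\<^esub> q \<otimes>\<^bsub>st_free\<^esub> l"
      have AY: "?A = commutator st_free (inv\<^bsub>st_free\<^esub> a) h" "?Y = commutator st_free l y"
        by (simp_all add: 2 defs st_section_def)
      have "near st_free st_R 1 ?Y (commutator st_free l (inv\<^bsub>st_free\<^esub> q))"
        unfolding AY by (intro st_R.near_commutator_right y) simp_all
      moreover have "w \<otimes>\<^bsub>st_free\<^esub> ?A \<otimes>\<^bsub>st_free\<^esub> inv\<^bsub>st_free\<^esub> w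
          \<otimes>\<^bsub>st_free\<^esub> commutator st_free l (inv\<^bsub>st_free\<^esub> q)
          = ?g \<otimes>\<^bsub>st_free\<^esub> commutator st_free z q \<otimes>\<^bsub>st_free\<^esub> inv\<^bsub>st_free\<^esub> ?g"
        unfolding AY by (simp add: qkz st_free.word_simps)
      ultimately show ?thesis
        using st_R.near_mult_left[of 1 ?Y "commutator st_free l (inv\<^bsub>st_free\<^esub> q)"
            "w \<otimes>\<^bsub>st_free\<^esub> ?A \<otimes>\<^bsub>st_free\<^esub> inv\<^bsub>st_free\<^esub> w"]
        by (intro bexI[of _ ?g]) simp_all
    qed
  qed
  then obtain g where "g \<in> carrier st_free" "near st_free st_R 1
      (w \<otimes>\<^bsub>st_free\<^esub> ?A \<otimes>\<^bsub>st_free\<^esub> inv\<^bsub>st_free\<^esub> w \<otimes>\<^bsub>st_free\<^esub> ?Y)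
      (g \<otimes>\<^bsub>st_free\<^esub> commutator st_free z q \<otimes>\<^bsub>st_free\<^esub> inv\<^bsub>st_free\<^esub> g)" by blast
  from st_R.near_trans[OF 1 st_R.near_trans[OF this(2) st_R.near_conj_one[OF central this(1)]]]
  show ?thesis by simp
qed

lemma near_st_lift_relator:
  assumes "r \<in> with_inverses st_free st_S"
  shows "near st_free st_R 5 (st_lift r) \<one>\<^bsub>st_free\<^esub>"
proof -
  have S: "near st_free st_R 5 (st_lift s) \<one>\<^bsub>st_free\<^esub>" if s: "s \<in> st_S" for s
  proof -
    consider \<alpha> a b where "\<alpha> \<in> {1, -1}" "s = st_r1 \<alpha> a b"
      | \<alpha> u t where "\<alpha> \<in> {1, -1}" "u \<noteq> 0" "s = st_r2 \<alpha> u t"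
      using s unfolding st_S_def by (elim UnE CollectE exE conjE)
    then show ?thesis
    proof cases
      case 1
      then show ?thesis using st_R.near_Suc[OF near_st_lift_r1] by (simp add: eval_nat_numeral)
    next
      case 2
      show ?thesis unfolding 2(3) using 2(1,2) by (rule near_st_lift_r2)
    qed
  qed
  consider "r \<in> st_S" | s where "s \<in> st_S" "r = inv\<^bsub>st_free\<^esub> s"
    using assms unfolding with_inverses_def by blast
  then show ?thesis
  proof cases
    case 2
    then have "s \<in> carrier st_free" using st_S_closed by blast
    then show ?thesis using st_R.near_inv[OF S[OF 2(1)]] 2(2) by simp
  qed (rule S)
qed

lemma near_st_lift_product:
  assumes "n \<in> product_lengths st_free (conjugates st_free (with_inverses st_free st_S)) x"
  shows "near st_free st_R (5 * n) (st_lift x) \<one>\<^bsub>st_free\<^esub>"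
  using assms
proof (induction n arbitrary: x)
  case 0
  then show ?case by (simp add: product_lengths_0_iff st_R.near_refl)
next
  case (Suc n)
  let ?C = "conjugates st_free (with_inverses st_free st_S)"
  have C: "?C \<subseteq> carrier st_free"
    by (intro st_free.conjugates_closed st_free.with_inverses_closed st_S_closed)
  obtain a y where ay: "a \<in> ?C" "n \<in> product_lengths st_free ?C y" "x = a \<otimes>\<^bsub>st_free\<^esub> y"
    using Suc.prems by (auto simp: product_lengths_Suc_iff)
  then obtain f r where fr: "f \<in> carrier st_free" "r \<in> with_inverses st_free st_S"
      "a = f \<otimes>\<^bsub>st_free\<^esub> r \<otimes>\<^bsub>st_free\<^esub> inv\<^bsub>st_free\<^esub> f"
    unfolding conjugates_def by blast
  have r: "r \<in> carrier st_free"
    using fr(2) st_free.with_inverses_closed[OF st_S_closed] by blast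
  have "near st_free st_R 5 (st_lift a) \<one>\<^bsub>st_free\<^esub>"
    using st_R.near_conj_one[OF near_st_lift_relator[OF fr(2)], of "st_lift f"] fr r by simp
  from st_R.near_mult[OF this Suc.IH[OF ay(2)]] show ?case
    using ay C st_free.product_lengths_closed[OF C ay(2)] by (auto simp: subset_iff)
qed

lemma commutator_near_one:
  fixes g h :: "(int \<times> 'k) word"
  assumes gh: "g \<in> carrier st_free" "h \<in> carrier st_free"
    and n: "n \<in> product_lengths st_free (conjugates st_free (with_inverses st_free st_S))
      (commutator st_free g h)"
  shows "near st_free st_R (5 * n + 2) (commutator st_free g h) \<one>\<^bsub>st_free\<^esub>"
proof -
  have 1: "near st_free st_R 1 (commutator st_free g h) (commutator st_free (st_lift g) h)"
    using gh by (intro st_R.near_commutator_left) (simp_all add: steinberg_class_st_lift)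
  have 2: "near st_free st_R 1 (commutator st_free (st_lift g) h)
      (commutator st_free (st_lift g) (st_lift h))"
    using gh by (intro st_R.near_commutator_right) (simp_all add: steinberg_class_st_lift)
  have 3: "near st_free st_R (5 * n) (commutator st_free (st_lift g) (st_lift h)) \<one>\<^bsub>st_free\<^esub>"
    using near_st_lift_product[OF n] gh by (simp add: lift.hom_commutator)
  from st_R.near_trans[OF 1 st_R.near_trans[OF 2 3]] show ?thesis by (simp add: add.commute)
qed

end

section \<open>The bound\<close>

lemma st_R_eq_products:
  "st_R = {x. product_lengths st_free (conjugates st_free (with_inverses st_free st_S)) x \<noteq> {}}"
  unfolding st_R_def by (rule st_free.normal_closure_eq[OF st_S_closed])

theorem theorem1p3:
  fixes g h :: "(int \<times> 'k::field) word"
  assumes "(6::'k) \<noteq> 0"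
    and "\<exists>c::'k. c ^ 2 = 2"
    and "g \<in> carrier st_free" and "h \<in> carrier st_free"
    and "(st_R #>\<^bsub>st_free\<^esub> g) \<otimes>\<^bsub>steinberg\<^esub> (st_R #>\<^bsub>st_free\<^esub> h)
       = (st_R #>\<^bsub>st_free\<^esub> h) \<otimes>\<^bsub>steinberg\<^esub> (st_R #>\<^bsub>st_free\<^esub> g)"
  shows "ocl_lengths g h \<noteq> {} \<and> ocl g h \<le> 5 * l_S (commutator st_free g h) + 2"
proof -
  obtain c :: 'k where c: "c\<^sup>2 = 2" using assms(2) by blast
  let ?C = "conjugates st_free (with_inverses st_free st_S)"
  have "steinberg_class (commutator st_free g h) = \<one>\<^bsub>steinberg\<^esub>"
    using assms(3-5) by (simp add: commutator_def quot.H.m_assoc quot.H.mult_inv_cancel_left)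
  then have "commutator st_free g h \<in> st_R"
    using assms(3,4) by (simp add: steinberg_class_eq_one_iff)
  then have "\<exists>n. n \<in> product_lengths st_free ?C (commutator st_free g h)"
    unfolding st_R_eq_products by blast
  then have "l_S (commutator st_free g h) \<in> product_lengths st_free ?C (commutator st_free g h)"
    unfolding l_S_def by (rule LeastI_ex)
  from commutator_near_one[OF c assms(1,3,4) this]
  have "5 * l_S (commutator st_free g h) + 2 \<in> ocl_lengths g h"
    using assms(3,4) by (simp add: near_def ocl_lengths_def mixed_commutators_def)
  then show ?thesis unfolding ocl_def by (auto intro: Least_le)
qed

end
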